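(* Let $G_n=(V(G_n),E(G_n))$, $n\geq 1$, be random graphs with $|V(G_n)|=n$. Assume that $G_n$ converges locally in probability to $(G,o)\sim\mu$, that $$\lim_{k\to\infty}\limsup_{n\to\infty}\frac{1}{n^2}\mathbb{E}\Big[\#\big\{(x,y)\in V(G_n)\times V(G_n)\colon |\mathscr{C}(x)|\geq k,\ |\mathscr{C}(y)|\geq k,\ x\notin\mathscr{C}(y)\big\}\Big]=0,$$ and that $\zeta=\mu(|\mathscr{C}(o)|=\infty)>0$. Then, for every integer $r\geq0$ and every $H_\star\in\mathscr{G}_\star$, as $n\to\infty$, $$\frac1n\sum_{v\in\mathscr{C}_{\rm max}}\mathbf{1}_{\{B_r^{(G_n)}(v)\simeq H_\star\}}\to\mu\big(|\mathscr{C}(o)|=\infty,\ B_r^{(G)}(o)\simeq H_\star\big)\quad\text{in probability},$$ and $$\frac1n\sum_{v\notin\mathscr{C}_{\rm max}}\mathbf{1}_{\{B_r^{(G_n)}(v)\simeq H_\star\}}\to\mu\big(|\mathscr{C}(o)|<\infty,\ B_r^{(G)}(o)\simeq H_\star\big)\quad\text{in probability}.$$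
   Context: Graphs $G=(V(G),E(G))$ are locally finite. For $v\in V(G)$, $\mathscr{C}(v)$ denotes the connected component of $v$, and $|\mathscr{C}(v)|$ its number of vertices. $\mathscr{C}_{\rm max}$ is the largest connected component of $G_n$ (ties broken arbitrarily). Local convergence in probability: Let $\mathscr{G}_\star$ be the set of (possibly infinite) locally finite connected rooted graphs modulo rooted isomorphism $\simeq$ (a bijection of vertex sets preserving the root and adjacency). With $d_G$ the graph distance, $B_r^{(G)}(o)$ is the subgraph rooted at $o$ with vertex set $\{u\colon d_G(o,u)\leq r\}$ and all edges of $G$ between such vertices. Let $\mu$ be a probability measure on $\mathscr{G}_\star$, and let $(G,o)\sim\mu$. Then $G_n$ converges locally in probability to $(G,o)\sim\mu$ when, for every integer $r\geq 0$ and $H_\star\in\mathscr{G}_\star$, $\frac{1}{|V(G_n)|}\sum_{v\in V(G_n)}\mathbf{1}_{\{B_r^{(G_n)}(v)\simeq H_\star\}}$ converges in probability to $\mu(B_r^{(G)}(o)\simeq H_\star)$. *)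

theory Defs
  imports "HOL-Probability.Probability" "HOL-Library.Extended_Nat"
begin

record 'v graph =
  verts :: "'v set"
  edges :: "'v set set"

definition simple_graph :: "'v graph \<Rightarrow> bool" where
  "simple_graph G \<longleftrightarrow>
     (\<forall>e\<in>edges G. \<exists>u\<in>verts G. \<exists>v\<in>verts G. u \<noteq> v \<and> e = {u, v})"

definition adj :: "'v graph \<Rightarrow> ('v \<times> 'v) set" where
  "adj G = {(u, v). {u, v} \<in> edges G}"

definition locally_finite :: "'v graph \<Rightarrow> bool" where
  "locally_finite G \<longleftrightarrow> (\<forall>v\<in>verts G. finite {u. (v, u) \<in> adj G})"

definition graph_dist :: "'v graph \<Rightarrow> 'v \<Rightarrow> 'v \<Rightarrow> enat" where
  "graph_dist G u v = (INF k\<in>{k. (u, v) \<in> adj G ^^ k}. enat k)"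

definition cluster :: "'v graph \<Rightarrow> 'v \<Rightarrow> 'v set" where
  "cluster G v = {u \<in> verts G. (v, u) \<in> (adj G)\<^sup>*}"

definition connected_graph :: "'v graph \<Rightarrow> bool" where
  "connected_graph G \<longleftrightarrow> (\<forall>u\<in>verts G. cluster G u = verts G)"

definition largest_cluster :: "'v graph \<Rightarrow> 'v set \<Rightarrow> bool" where
  "largest_cluster G C \<longleftrightarrow>
     C \<in> cluster G ` verts G \<and> (\<forall>v\<in>verts G. card (cluster G v) \<le> card C)"

type_synonym 'v rooted_graph = "'v graph \<times> 'v"

definition graph_ball :: "nat \<Rightarrow> 'v rooted_graph \<Rightarrow> 'v rooted_graph" where
  "graph_ball r = (\<lambda>(G, o').
     let B = {u \<in> verts G. graph_dist G o' u \<le> enat r}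
     in (\<lparr>verts = B, edges = {e \<in> edges G. e \<subseteq> B}\<rparr>, o'))"

definition rooted_iso :: "'v rooted_graph \<Rightarrow> 'w rooted_graph \<Rightarrow> bool" where
  "rooted_iso = (\<lambda>(G, o') (H, p).
     \<exists>f. bij_betw f (verts G) (verts H) \<and> f o' = p \<and>
         (\<forall>u\<in>verts G. \<forall>v\<in>verts G. (u, v) \<in> adj G \<longleftrightarrow> (f u, f v) \<in> adj H))"

text \<open>A connected locally finite graph has countably many vertices, so every isomorphism class
  has a representative whose vertices are natural numbers. Hence it is enough to quotient the
  rooted graphs with vertex set contained in the natural numbers.\<close>

definition nat_rooted_graphs :: "nat rooted_graph set" where
  "nat_rooted_graphs = {(G, o').
     simple_graph G \<and> locally_finite G \<and> connected_graph G \<and> o' \<in> verts G}"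

definition rooted_iso_rel :: "(nat rooted_graph \<times> nat rooted_graph) set" where
  "rooted_iso_rel =
     {(X, Y). X \<in> nat_rooted_graphs \<and> Y \<in> nat_rooted_graphs \<and> rooted_iso X Y}"

lemma equiv_rooted_iso_rel: "equiv nat_rooted_graphs rooted_iso_rel"
proof (rule equivI)
  show "rooted_iso_rel \<subseteq> nat_rooted_graphs \<times> nat_rooted_graphs"
    by (auto simp: rooted_iso_rel_def)
  have "rooted_iso X X" for X :: "nat rooted_graph"
    unfolding rooted_iso_def by (auto split: prod.splits intro!: exI[of _ id])
  then show "refl_on nat_rooted_graphs rooted_iso_rel"
    by (auto simp: refl_on_def rooted_iso_rel_def)
  have "rooted_iso Y X" if asm: "rooted_iso X Y" "X \<in> nat_rooted_graphs" for X Y :: "nat rooted_graph"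
  proof -
    obtain G a H b where XY: "X = (G, a)" "Y = (H, b)" by (cases X, cases Y) auto
    obtain f where f: "bij_betw f (verts G) (verts H)" "f a = b"
      "\<And>u v. u \<in> verts G \<Longrightarrow> v \<in> verts G \<Longrightarrow> (u, v) \<in> adj G \<longleftrightarrow> (f u, f v) \<in> adj H"
      using asm(1) unfolding rooted_iso_def XY prod.case by blast
    have a: "a \<in> verts G" using asm(2) by (auto simp: nat_rooted_graphs_def XY)
    let ?g = "inv_into (verts G) f"
    have "bij_betw ?g (verts H) (verts G)" by (rule bij_betw_inv_into[OF f(1)])
    moreover have "?g b = a" using f a by (metis bij_betw_inv_into_left)
    moreover have "(u, v) \<in> adj H \<longleftrightarrow> (?g u, ?g v) \<in> adj G"
      if "u \<in> verts H" "v \<in> verts H" for u v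
    proof -
      have "?g u \<in> verts G" "?g v \<in> verts G"
        using that calculation(1) by (auto simp: bij_betw_apply)
      from f(3)[OF this] show ?thesis
        using that by (simp add: bij_betw_inv_into_right[OF f(1)])
    qed
    ultimately show ?thesis unfolding rooted_iso_def XY prod.case by blast
  qed
  then show "sym rooted_iso_rel" by (auto simp: sym_def rooted_iso_rel_def)
  have "rooted_iso X Z" if XYZ: "rooted_iso X Y" "rooted_iso Y Z" for X Y Z :: "nat rooted_graph"
  proof -
    obtain G a H b K c where eqs: "X = (G, a)" "Y = (H, b)" "Z = (K, c)"
      by (cases X, cases Y, cases Z) auto
    obtain f where f: "bij_betw f (verts G) (verts H)" "f a = b"
      "\<And>u v. u \<in> verts G \<Longrightarrow> v \<in> verts G \<Longrightarrow> (u, v) \<in> adj G \<longleftrightarrow> (f u, f v) \<in> adj H"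
      using XYZ(1) unfolding rooted_iso_def eqs prod.case by blast
    obtain g where g: "bij_betw g (verts H) (verts K)" "g b = c"
      "\<And>u v. u \<in> verts H \<Longrightarrow> v \<in> verts H \<Longrightarrow> (u, v) \<in> adj H \<longleftrightarrow> (g u, g v) \<in> adj K"
      using XYZ(2) unfolding rooted_iso_def eqs prod.case by blast
    have "bij_betw (g \<circ> f) (verts G) (verts K)" using f(1) g(1) by (rule bij_betw_trans)
    moreover have "(u, v) \<in> adj G \<longleftrightarrow> ((g \<circ> f) u, (g \<circ> f) v) \<in> adj K"
      if "u \<in> verts G" "v \<in> verts G" for u v
      using f g that by (simp add: bij_betw_apply)
    moreover have "(g \<circ> f) a = c" using f(2) g(2) by simp
    ultimately show ?thesis unfolding rooted_iso_def eqs prod.case by blast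
  qed
  then show "trans rooted_iso_rel" unfolding trans_def rooted_iso_rel_def by blast
qed

definition G_star :: "nat rooted_graph set set" where
  "G_star = nat_rooted_graphs // rooted_iso_rel"

text \<open>A rooted graph, on any vertex type, is isomorphic to the (representatives of the) class
  \<open>H\<close>.\<close>

definition iso_class :: "'v rooted_graph \<Rightarrow> nat rooted_graph set \<Rightarrow> bool" (infix "\<simeq>\<^sub>\<star>" 50) where
  "X \<simeq>\<^sub>\<star> H \<longleftrightarrow> (\<exists>Y\<in>H. rooted_iso X Y)"

text \<open>The event that the random rooted graph has property \<open>P\<close>. The properties used below are
  invariant under rooted isomorphism, so the choice of representative is immaterial.\<close>

definition event :: "(nat rooted_graph \<Rightarrow> bool) \<Rightarrow> nat rooted_graph set set" where
  "event P = {X \<in> G_star. \<exists>Y\<in>X. P Y}"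

text \<open>The Borel \<open>\<sigma>\<close>-algebra of the local topology on the space of rooted graphs: there are
  countably many classes of finite rooted graphs, and the events below are the balls (and form a
  countable base) of that topology.\<close>

definition local_borel :: "nat rooted_graph set measure" where
  "local_borel = sigma G_star {event (\<lambda>X. graph_ball r X \<simeq>\<^sub>\<star> H) | r H. H \<in> G_star}"

text \<open>Measurability is with respect to the discrete \<open>\<sigma>\<close>-algebra. For graphs on a fixed finite
  vertex set, or finite graphs on a countable vertex type, it amounts to measurability of the
  events that a given vertex or edge is present.\<close>

definition random_graph :: "'a measure \<Rightarrow> ('a \<Rightarrow> 'v graph) \<Rightarrow> bool" where
  "random_graph M G \<longleftrightarrow> prob_space M \<and> G \<in> measurable M (count_space UNIV) \<and>
     (\<forall>\<omega>\<in>space M. simple_graph (G \<omega>) \<and> locally_finite (G \<omega>))"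

text \<open>The variables may live on different probability spaces; the limit is a constant.\<close>

definition tendsto_in_prob :: "(nat \<Rightarrow> 'a measure) \<Rightarrow> (nat \<Rightarrow> 'a \<Rightarrow> real) \<Rightarrow> real \<Rightarrow> bool" where
  "tendsto_in_prob M X c \<longleftrightarrow>
     (\<forall>\<epsilon>>0. (\<lambda>n. \<P>(\<omega> in M n. \<bar>X n \<omega> - c\<bar> > \<epsilon>)) \<longlonglongrightarrow> 0)"

definition tendsto_locally_in_prob ::
    "(nat \<Rightarrow> 'a measure) \<Rightarrow> (nat \<Rightarrow> 'a \<Rightarrow> 'v graph) \<Rightarrow> nat rooted_graph set measure \<Rightarrow> bool" where
  "tendsto_locally_in_prob M G \<mu> \<longleftrightarrow>
     (\<forall>r. \<forall>H\<in>G_star. tendsto_in_prob M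
        (\<lambda>n \<omega>. 1 / real (card (verts (G n \<omega>))) *
           (\<Sum>v\<in>verts (G n \<omega>). of_bool (graph_ball r (G n \<omega>, v) \<simeq>\<^sub>\<star> H)))
        (measure \<mu> (event (\<lambda>X. graph_ball r X \<simeq>\<^sub>\<star> H))))"

end

theory Submission
  imports Defs
begin

text \<open>
Fix \<open>k\<close>. Whether the component of a vertex has at least \<open>k\<close> vertices, and which graph the ball of
radius \<open>r\<close> around it is, can both be read off from one ball of large enough radius. Local
convergence therefore controls the fraction \<open>A\<^sub>k\<close> of vertices that lie in a component of size at
least \<open>k\<close> and have the prescribed ball, as well as the fraction \<open>Z\<^sub>k\<close> of all vertices in such
components. As \<open>k\<close> grows, the limits of these fractions decrease to the probabilities of the
corresponding events with an infinite component; in particular \<open>Z\<^sub>k\<close> is eventually at least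
\<open>\<zeta> / 2\<close> with high probability, for every \<open>k\<close>.

It remains to replace the union of all large components by the largest one. Let \<open>L\<close> be this union
and \<open>C\<close> the largest component. A vertex \<open>y\<close> in \<open>L\<close> forms a pair with each of the at least
\<open>card L - card C\<close> vertices \<open>x\<close> in \<open>L\<close> outside its own component, so there are at least
\<open>card L * (card L - card C)\<close> pairs of vertices in different large components. If
\<open>card L\<close> is at least \<open>\<zeta> * n / 2\<close>, then \<open>(card L - card C) / n\<close> is at most
\<open>2 / \<zeta>\<close> times the number of pairs divided by \<open>n\<^sup>2\<close>, and Markov's inequality with the assumption on
pairs makes this small when \<open>k\<close> is large (\<open>largest_cluster_fraction_close\<close>,
\<open>giant_fraction_close\<close>). The vertices outside the largest component are what is left over from
the fraction of all vertices with the prescribed ball (\<open>nongiant_fraction_close\<close>).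

Local convergence is given for one isomorphism class at a time, whereas a property of balls is in
general a countable union of classes. This interchange of limits is \<open>vertex_fraction_close\<close>:
finitely many classes already carry almost all of the limiting mass of the property, which gives the
lower bound, and the lower bound for the complementary property is the upper bound.
\<close>

section \<open>Balls and components\<close>

text \<open>In contrast to \<open>nat_rooted_graphs\<close>, no connectivity: the random graphs may be disconnected, and a ball
in them sees only the component of its centre.\<close>

definition rooted_loc_fin :: "'v rooted_graph \<Rightarrow> bool" where
  "rooted_loc_fin = (\<lambda>(G, o'). simple_graph G \<and> locally_finite G \<and> o' \<in> verts G)"

lemma rooted_loc_fin_if_nat_rooted: "Y \<in> nat_rooted_graphs \<Longrightarrow> rooted_loc_fin Y"
  by (auto simp: nat_rooted_graphs_def rooted_loc_fin_def)

lemma adj_in_verts: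
  assumes "simple_graph G" "(u, v) \<in> adj G"
  shows "u \<in> verts G" "v \<in> verts G"
  using assms unfolding simple_graph_def adj_def by (force simp: doubleton_eq_iff)+

lemma sym_adj: "sym (adj G)"
  by (auto simp: sym_def adj_def insert_commute)

text \<open>Distances are used only through this characterisation by walks; it also covers vertices that
are not reachable, whose distance is the infimum of the empty set.\<close>

lemma graph_dist_le_iff:
  "graph_dist G u v \<le> enat r \<longleftrightarrow> (\<exists>k\<le>r. (u, v) \<in> adj G ^^ k)"
proof
  assume le: "graph_dist G u v \<le> enat r"
  show "\<exists>k\<le>r. (u, v) \<in> adj G ^^ k"
  proof (rule ccontr)
    assume "\<not> ?thesis"
    then have "enat (Suc r) \<le> graph_dist G u v"
      unfolding graph_dist_def by (intro INF_greatest) (auto simp: not_less_eq_eq[symmetric])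
    with le show False by (metis Suc_n_not_le_n enat_ord_simps(1) order_trans)
  qed
next
  assume "\<exists>k\<le>r. (u, v) \<in> adj G ^^ k"
  then obtain k where k: "k \<le> r" "(u, v) \<in> adj G ^^ k" by blast
  have "graph_dist G u v \<le> enat k"
    unfolding graph_dist_def using k by (intro INF_lower) auto
  then show "graph_dist G u v \<le> enat r"
    using k by (meson enat_ord_simps(1) order_trans)
qed

lemma verts_graph_ball:
  "verts (fst (graph_ball r (G, a))) = {u \<in> verts G. \<exists>k\<le>r. (a, u) \<in> adj G ^^ k}"
  by (simp add: graph_ball_def Let_def graph_dist_le_iff)

lemma snd_graph_ball [simp]: "snd (graph_ball r X) = snd X"
  by (auto simp: graph_ball_def Let_def split: prod.splits)

lemma adj_graph_ball:
  "(u, v) \<in> adj (fst (graph_ball r (G, a))) \<longleftrightarrow>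
     (u, v) \<in> adj G \<and> u \<in> verts (fst (graph_ball r (G, a))) \<and> v \<in> verts (fst (graph_ball r (G, a)))"
  by (auto simp: graph_ball_def Let_def adj_def)

lemma edges_graph_ball:
  "edges (fst (graph_ball r (G, a))) = {e \<in> edges G. e \<subseteq> verts (fst (graph_ball r (G, a)))}"
  by (auto simp: graph_ball_def Let_def)

text \<open>A walk of length at most \<open>m\<close> from the root never leaves the ball of radius \<open>m\<close>, so the
  distances from the root that the ball sees are the true ones.\<close>

lemma relpow_adj_graph_ball:
  assumes "simple_graph G" "a \<in> verts G" "k \<le> m"
  shows "(a, u) \<in> adj (fst (graph_ball m (G, a))) ^^ k \<longleftrightarrow> (a, u) \<in> adj G ^^ k"
proof
  show "(a, u) \<in> adj (fst (graph_ball m (G, a))) ^^ k \<Longrightarrow> (a, u) \<in> adj G ^^ k"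
  proof (induction k arbitrary: u)
    case (Suc k)
    then show ?case unfolding relpow.simps by (meson adj_graph_ball relcomp.cases relcompI Pair_inject)
  qed simp
  show "(a, u) \<in> adj G ^^ k \<Longrightarrow> (a, u) \<in> adj (fst (graph_ball m (G, a))) ^^ k"
    using assms(3)
  proof (induction k arbitrary: u)
    case (Suc k)
    then obtain w where w: "(a, w) \<in> adj G ^^ k" "(w, u) \<in> adj G" by auto
    note wu = adj_in_verts[OF assms(1) w(2)]
    have "w \<in> verts (fst (graph_ball m (G, a)))"
      using w(1) wu Suc.prems by (auto simp: verts_graph_ball intro: exI[of _ k])
    moreover have "u \<in> verts (fst (graph_ball m (G, a)))"
      using wu Suc.prems unfolding verts_graph_ball by blast
    ultimately have "(w, u) \<in> adj (fst (graph_ball m (G, a)))"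
      using w(2) by (simp add: adj_graph_ball)
    moreover have "(a, w) \<in> adj (fst (graph_ball m (G, a))) ^^ k"
      using Suc.IH w(1) Suc.prems by simp
    ultimately show ?case by auto
  qed auto
qed

lemma verts_graph_ball_mono:
  assumes "r \<le> m"
  shows "verts (fst (graph_ball r X)) \<subseteq> verts (fst (graph_ball m X))"
proof (cases X)
  case (Pair G a)
  then show ?thesis using assms by (auto simp: verts_graph_ball intro: order_trans)
qed

lemma graph_ball_graph_ball:
  assumes "rooted_loc_fin X" "r \<le> m"
  shows "graph_ball r (graph_ball m X) = graph_ball r X"
proof (cases X)
  case (Pair G a)
  with assms have G: "simple_graph G" "a \<in> verts G" by (auto simp: rooted_loc_fin_def)
  let ?B = "fst (graph_ball m (G, a))"
  have eq: "graph_ball m (G, a) = (?B, a)"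
    by (metis prod.collapse snd_conv snd_graph_ball)
  have "(a, u) \<in> adj ?B ^^ k \<longleftrightarrow> (a, u) \<in> adj G ^^ k" if "k \<le> r" for k u
    using relpow_adj_graph_ball[OF G] that assms(2) by simp
  then have v: "verts (fst (graph_ball r (?B, a))) = verts (fst (graph_ball r (G, a)))"
    using assms(2) unfolding verts_graph_ball[of r] verts_graph_ball[of m] mem_Collect_eq
    by (metis (no_types, lifting) order_trans)
  moreover have "edges (fst (graph_ball r (?B, a))) = edges (fst (graph_ball r (G, a)))"
    using verts_graph_ball_mono[OF assms(2), of "(G, a)"]
    by (auto simp: edges_graph_ball[of r] edges_graph_ball[of m] v)
  ultimately show ?thesis
    unfolding Pair by (subst eq, intro prod_eqI graph.equality) simp_all
qed

lemma root_in_graph_ball: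
  assumes "rooted_loc_fin X"
  shows "snd X \<in> verts (fst (graph_ball r X))"
proof (cases X)
  case (Pair G a)
  then show ?thesis using assms
    by (auto simp: rooted_loc_fin_def verts_graph_ball intro!: exI[of _ 0])
qed

lemma finite_graph_ball:
  assumes "rooted_loc_fin X"
  shows "finite (verts (fst (graph_ball r X)))"
proof (cases X)
  case (Pair G a)
  have G: "simple_graph G" "locally_finite G"
    using assms by (auto simp: rooted_loc_fin_def Pair)
  have "finite {u. (a, u) \<in> adj G ^^ k}" for k
  proof (induction k)
    case (Suc k)
    have "{u. (a, u) \<in> adj G ^^ Suc k} = (\<Union>w\<in>{w. (a, w) \<in> adj G ^^ k}. {u. (w, u) \<in> adj G})"
      by auto
    moreover have "finite {u. (w, u) \<in> adj G}" for w
    proof (cases "w \<in> verts G")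
      case False
      then have "{u. (w, u) \<in> adj G} = {}" using adj_in_verts(1)[OF G(1)] by auto
      then show ?thesis by simp
    qed (use G(2) in \<open>simp add: locally_finite_def\<close>)
    ultimately show ?case using Suc by simp
  qed auto
  moreover have "verts (fst (graph_ball r X)) \<subseteq> (\<Union>k\<le>r. {u. (a, u) \<in> adj G ^^ k})"
    unfolding Pair verts_graph_ball by auto
  ultimately show ?thesis by (meson finite_UN finite_atMost rev_finite_subset)
qed

lemma graph_ball_in_nat_rooted_graphs:
  assumes "X \<in> nat_rooted_graphs"
  shows "graph_ball r X \<in> nat_rooted_graphs"
proof (cases X)
  case (Pair G a)
  let ?B = "fst (graph_ball r (G, a))"
  have G: "simple_graph G" "locally_finite G" "a \<in> verts G"
    using assms by (auto simp: nat_rooted_graphs_def Pair)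
  have wf: "rooted_loc_fin (G, a)" using G by (simp add: rooted_loc_fin_def)
  have sB: "simple_graph ?B"
    using G(1) unfolding simple_graph_def by (fastforce simp: edges_graph_ball)
  have "locally_finite ?B"
    unfolding locally_finite_def
    using finite_graph_ball[OF wf, of r] adj_in_verts(2)[OF sB] by (auto intro: finite_subset)
  moreover have reach: "(a, u) \<in> (adj ?B)\<^sup>*" if "u \<in> verts ?B" for u
  proof -
    obtain k where "k \<le> r" "(a, u) \<in> adj G ^^ k" using \<open>u \<in> verts ?B\<close> by (auto simp: verts_graph_ball)
    then show ?thesis using relpow_adj_graph_ball[OF G(1,3)] relpow_imp_rtrancl by metis
  qed
  have "connected_graph ?B"
    unfolding connected_graph_def cluster_def
    using reach sym_rtrancl[OF sym_adj, of ?B] by (blast dest: symD intro: rtrancl_trans)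
  moreover have "a \<in> verts ?B" using root_in_graph_ball[OF wf] by simp
  ultimately show ?thesis
    using sB reach unfolding Pair nat_rooted_graphs_def mem_Collect_eq split_beta by simp
qed

lemma rooted_iso_sym:
  assumes "rooted_iso X Y" "snd X \<in> verts (fst X)"
  shows "rooted_iso Y X"
proof -
  obtain G a H b where XY: "X = (G, a)" "Y = (H, b)" by (cases X, cases Y) auto
  obtain f where f: "bij_betw f (verts G) (verts H)" "f a = b"
    "\<And>u v. u \<in> verts G \<Longrightarrow> v \<in> verts G \<Longrightarrow> (u, v) \<in> adj G \<longleftrightarrow> (f u, f v) \<in> adj H"
    using assms(1) unfolding rooted_iso_def XY prod.case by blast
  let ?g = "inv_into (verts G) f"
  have g: "bij_betw ?g (verts H) (verts G)" by (rule bij_betw_inv_into[OF f(1)])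
  moreover have "?g b = a"
    using f assms(2) XY by (metis bij_betw_inv_into_left fst_conv snd_conv)
  moreover have "(u, v) \<in> adj H \<longleftrightarrow> (?g u, ?g v) \<in> adj G"
    if "u \<in> verts H" "v \<in> verts H" for u v
    using that f(3)[of "?g u" "?g v"] g
    by (simp add: bij_betw_apply bij_betw_inv_into_right[OF f(1)])
  ultimately show ?thesis unfolding rooted_iso_def XY prod.case by blast
qed

lemma rooted_iso_trans:
  assumes "rooted_iso X Y" "rooted_iso Y Z"
  shows "rooted_iso X Z"
proof -
  obtain G a H b K c where eqs: "X = (G, a)" "Y = (H, b)" "Z = (K, c)"
    by (cases X, cases Y, cases Z) auto
  obtain f where f: "bij_betw f (verts G) (verts H)" "f a = b"
    "\<And>u v. u \<in> verts G \<Longrightarrow> v \<in> verts G \<Longrightarrow> (u, v) \<in> adj G \<longleftrightarrow> (f u, f v) \<in> adj H"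
    using assms(1) unfolding rooted_iso_def eqs prod.case by blast
  obtain g where g: "bij_betw g (verts H) (verts K)" "g b = c"
    "\<And>u v. u \<in> verts H \<Longrightarrow> v \<in> verts H \<Longrightarrow> (u, v) \<in> adj H \<longleftrightarrow> (g u, g v) \<in> adj K"
    using assms(2) unfolding rooted_iso_def eqs prod.case by blast
  have "bij_betw (g \<circ> f) (verts G) (verts K)" using f(1) g(1) by (rule bij_betw_trans)
  moreover have "(u, v) \<in> adj G \<longleftrightarrow> ((g \<circ> f) u, (g \<circ> f) v) \<in> adj K"
    if "u \<in> verts G" "v \<in> verts G" for u v
    using f g that by (simp add: bij_betw_apply)
  moreover have "(g \<circ> f) a = c" using f(2) g(2) by simp
  ultimately show ?thesis unfolding rooted_iso_def eqs prod.case by blast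
qed

lemma rooted_iso_graph_ball:
  assumes iso: "rooted_iso X Y" and wf: "rooted_loc_fin X" "simple_graph (fst Y)"
  shows "rooted_iso (graph_ball r X) (graph_ball r Y)"
proof -
  obtain G a H b where XY: "X = (G, a)" "Y = (H, b)" by (cases X, cases Y) auto
  obtain f where f: "bij_betw f (verts G) (verts H)" "f a = b"
    "\<And>u v. u \<in> verts G \<Longrightarrow> v \<in> verts G \<Longrightarrow> (u, v) \<in> adj G \<longleftrightarrow> (f u, f v) \<in> adj H"
    using iso unfolding rooted_iso_def XY prod.case by blast
  have G: "simple_graph G" "a \<in> verts G" and H: "simple_graph H"
    using wf by (auto simp: rooted_loc_fin_def XY)
  have walk: "(a, u) \<in> adj G ^^ k \<longleftrightarrow> (b, f u) \<in> adj H ^^ k" if "u \<in> verts G" for u k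
    using that
  proof (induction k arbitrary: u)
    case 0
    then show ?case using f(1,2) G(2) by (auto simp: bij_betw_def inj_on_def)
  next
    case (Suc k)
    have "(b, f u) \<in> adj H ^^ Suc k \<longleftrightarrow> (\<exists>w'\<in>verts H. (b, w') \<in> adj H ^^ k \<and> (w', f u) \<in> adj H)"
      using adj_in_verts(1)[OF H] by auto
    also have "\<dots> \<longleftrightarrow> (\<exists>w\<in>verts G. (b, f w) \<in> adj H ^^ k \<and> (f w, f u) \<in> adj H)"
      unfolding bij_betw_imp_surj_on[OF f(1), symmetric] by blast
    also have "\<dots> \<longleftrightarrow> (\<exists>w\<in>verts G. (a, w) \<in> adj G ^^ k \<and> (w, u) \<in> adj G)"
      using Suc f(3) by auto
    also have "\<dots> \<longleftrightarrow> (a, u) \<in> adj G ^^ Suc k"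
      using adj_in_verts(1)[OF G(1)] by auto
    finally show ?case by simp
  qed
  have img: "f ` verts (fst (graph_ball r X)) = verts (fst (graph_ball r Y))"
    unfolding XY verts_graph_ball bij_betw_imp_surj_on[OF f(1), symmetric] using walk by auto
  have sub: "verts (fst (graph_ball r X)) \<subseteq> verts G"
    unfolding XY verts_graph_ball by auto
  have bij: "bij_betw f (verts (fst (graph_ball r X))) (verts (fst (graph_ball r Y)))"
    using img sub f(1) by (auto simp: bij_betw_def intro: inj_on_subset)
  have "(u, v) \<in> adj (fst (graph_ball r X)) \<longleftrightarrow> (f u, f v) \<in> adj (fst (graph_ball r Y))"
    if "u \<in> verts (fst (graph_ball r X))" "v \<in> verts (fst (graph_ball r X))" for u v
    using that f(3) sub img unfolding XY adj_graph_ball by blast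
  then show ?thesis
    unfolding rooted_iso_def using bij f(2) XY
    by (auto simp: split_beta intro!: exI[of _ f])
qed

text \<open>A walk from the root that leaves the ball of radius \<open>j\<close> reaches, at its first step out of it, a
vertex at distance exactly \<open>j + 1\<close>.\<close>

lemma cluster_subset_graph_ball:
  assumes "rooted_loc_fin (G, a)"
    and stable: "verts (fst (graph_ball (Suc j) (G, a))) = verts (fst (graph_ball j (G, a)))"
  shows "cluster G a \<subseteq> verts (fst (graph_ball j (G, a)))"
proof
  fix u assume "u \<in> cluster G a"
  then have "(a, u) \<in> (adj G)\<^sup>*" by (simp add: cluster_def)
  then show "u \<in> verts (fst (graph_ball j (G, a)))"
  proof induction
    case base
    then show ?case using root_in_graph_ball[OF assms(1)] by simp
  next
    case (step w u)
    then obtain k where k: "k \<le> j" "(a, w) \<in> adj G ^^ k" by (auto simp: verts_graph_ball)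
    have "(a, u) \<in> adj G ^^ Suc k" using k step.hyps by auto
    moreover have "u \<in> verts G"
      using adj_in_verts(2) step.hyps assms(1) by (fastforce simp: rooted_loc_fin_def)
    ultimately have "u \<in> verts (fst (graph_ball (Suc j) (G, a)))"
      unfolding verts_graph_ball using k(1) Suc_le_mono by blast
    then show ?case by (simp add: stable)
  qed
qed

text \<open>In the finite random graphs this compares a cardinality with \<open>k\<close>; the first disjunct is for the limit,
since \<open>card\<close> sends infinite sets to 0.\<close>

definition cluster_at_least :: "nat \<Rightarrow> 'v rooted_graph \<Rightarrow> bool" where
  "cluster_at_least k = (\<lambda>(G, v). infinite (cluster G v) \<or> k \<le> card (cluster G v))"

text \<open>As long as a ball is not yet the whole component, each unit of radius adds a vertex. So the
  ball of radius \<open>k\<close> decides whether the component has at least \<open>k\<close> vertices.\<close>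

lemma cluster_at_least_iff_graph_ball:
  assumes wf: "rooted_loc_fin X"
  shows "cluster_at_least k X \<longleftrightarrow> k \<le> card (verts (fst (graph_ball k X)))"
proof -
  obtain G a where X: "X = (G, a)" by (cases X)
  let ?V = "\<lambda>j. verts (fst (graph_ball j (G, a)))"
  have sub: "?V j \<subseteq> cluster G a" for j
    by (auto simp: verts_graph_ball cluster_def dest: relpow_imp_rtrancl)
  have fin: "finite (?V j)" for j using finite_graph_ball wf X by blast
  show ?thesis
  proof (cases "cluster G a \<subseteq> ?V k")
    case True
    then have "cluster G a = ?V k" using sub by blast
    then show ?thesis using fin by (simp add: cluster_at_least_def X)
  next
    case False
    have grow: "Suc j \<le> card (?V j)" if "j \<le> k" for j
      using that
    proof (induction j)
      case 0
      have "a \<in> ?V 0" using root_in_graph_ball[OF wf] X by simp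
      then show ?case using fin by (metis One_nat_def Suc_leI card_gt_0_iff empty_iff)
    next
      case (Suc j)
      have "?V (Suc j) \<noteq> ?V j"
      proof
        assume "?V (Suc j) = ?V j"
        then have "cluster G a \<subseteq> ?V j" using cluster_subset_graph_ball wf X by metis
        then show False
          using False verts_graph_ball_mono[of j k] Suc.prems by (meson Suc_leD subset_trans)
      qed
      then have "?V j \<subset> ?V (Suc j)" using verts_graph_ball_mono[of j "Suc j" "(G, a)"] by simp
      then have "card (?V j) < card (?V (Suc j))" using fin by (simp add: psubset_card_mono)
      then show ?case using Suc by simp
    qed
    then have "k \<le> card (?V k)" by (meson Suc_leD order_refl)
    moreover have "finite (cluster G a) \<Longrightarrow> card (?V k) \<le> card (cluster G a)"
      using sub by (simp add: card_mono)
    ultimately show ?thesis by (auto simp: cluster_at_least_def X)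
  qed
qed

lemma rooted_iso_card_verts:
  assumes "rooted_iso X Y"
  shows "card (verts (fst X)) = card (verts (fst Y))"
  using assms by (auto simp: rooted_iso_def split_beta bij_betw_same_card)

section \<open>Properties determined by a ball\<close>

text \<open>The random graphs and the representatives of the limit have different vertex types. So a property
is given by two predicates, one for each type, and \<open>ball_determined m P Q\<close> says both that it
depends only on the ball of radius \<open>m\<close> and that \<open>P\<close> and \<open>Q\<close> express the same property.\<close>

definition ball_determined ::
    "nat \<Rightarrow> ('v rooted_graph \<Rightarrow> bool) \<Rightarrow> (nat rooted_graph \<Rightarrow> bool) \<Rightarrow> bool" where
  "ball_determined m P Q \<longleftrightarrow> (\<forall>X Y. rooted_loc_fin X \<longrightarrow> Y \<in> nat_rooted_graphs \<longrightarrow>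
     rooted_iso (graph_ball m X) (graph_ball m Y) \<longrightarrow> (P X \<longleftrightarrow> Q Y))"

lemma ball_determinedD:
  "\<lbrakk>ball_determined m P Q; rooted_loc_fin X; Y \<in> nat_rooted_graphs;
    rooted_iso (graph_ball m X) (graph_ball m Y)\<rbrakk> \<Longrightarrow> P X \<longleftrightarrow> Q Y"
  unfolding ball_determined_def by blast

lemma ball_determined_Not:
  "ball_determined m P Q \<Longrightarrow> ball_determined m (\<lambda>X. \<not> P X) (\<lambda>X. \<not> Q X)"
  by (auto simp: ball_determined_def)

lemma iso_class_cong:
  assumes "rooted_iso X Y" "snd X \<in> verts (fst X)"
  shows "X \<simeq>\<^sub>\<star> H \<longleftrightarrow> Y \<simeq>\<^sub>\<star> H"
  unfolding iso_class_def
  using rooted_iso_trans[OF assms(1)] rooted_iso_trans[OF rooted_iso_sym[OF assms]] by blast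

lemma rooted_loc_fin_graph_ball:
  assumes "rooted_loc_fin X"
  shows "rooted_loc_fin (graph_ball m X)"
proof (cases X)
  case (Pair G a)
  let ?B = "fst (graph_ball m X)"
  have "simple_graph G" using assms by (auto simp: rooted_loc_fin_def Pair)
  then have s: "simple_graph ?B"
    unfolding simple_graph_def Pair by (fastforce simp: edges_graph_ball)
  moreover have "locally_finite ?B"
    unfolding locally_finite_def using finite_graph_ball[OF assms] adj_in_verts(2)[OF s]
    by (auto intro: finite_subset)
  ultimately show ?thesis
    using root_in_graph_ball[OF assms, of m] by (simp add: rooted_loc_fin_def split_beta)
qed

text \<open>Isomorphisms preserve distances from the root, so they restrict to concentric balls; and a smaller
ball can be taken inside the larger one.\<close>

lemma rooted_iso_smaller_graph_ball:
  assumes "rooted_iso (graph_ball m X) (graph_ball m Y)" "j \<le> m"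
    and X: "rooted_loc_fin X" and Y: "rooted_loc_fin Y"
  shows "rooted_iso (graph_ball j X) (graph_ball j Y)"
  using rooted_iso_graph_ball[OF assms(1) rooted_loc_fin_graph_ball[OF X], of j]
    rooted_loc_fin_graph_ball[OF Y, of m] graph_ball_graph_ball[OF X assms(2)]
    graph_ball_graph_ball[OF Y assms(2)]
  by (simp add: rooted_loc_fin_def split_beta)

lemma ball_determined_mono:
  fixes P :: "'v rooted_graph \<Rightarrow> bool"
  assumes "ball_determined j P Q" "j \<le> m"
  shows "ball_determined m P Q"
  unfolding ball_determined_def
proof (intro allI impI)
  fix X :: "'v rooted_graph" and Y
  assume X: "rooted_loc_fin X" and Y: "Y \<in> nat_rooted_graphs"
    and iso: "rooted_iso (graph_ball m X) (graph_ball m Y)"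
  show "P X \<longleftrightarrow> Q Y"
    using rooted_iso_smaller_graph_ball[OF iso assms(2) X rooted_loc_fin_if_nat_rooted[OF Y]]
    by (rule ball_determinedD[OF assms(1) X Y])
qed

lemma ball_determined_graph_ball:
  "ball_determined m (\<lambda>X. graph_ball m X \<simeq>\<^sub>\<star> H) (\<lambda>X. graph_ball m X \<simeq>\<^sub>\<star> H)"
  unfolding ball_determined_def
proof (intro allI impI)
  fix X :: "'v rooted_graph" and Y :: "nat rooted_graph"
  assume "rooted_loc_fin X" and iso: "rooted_iso (graph_ball m X) (graph_ball m Y)"
  then show "graph_ball m X \<simeq>\<^sub>\<star> H \<longleftrightarrow> graph_ball m Y \<simeq>\<^sub>\<star> H"
    using root_in_graph_ball[of X m] by (intro iso_class_cong[OF iso]) simp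
qed

lemma ball_determined_cluster_at_least:
  "ball_determined k (cluster_at_least k) (cluster_at_least k)"
  unfolding ball_determined_def
proof (intro allI impI)
  fix X :: "'v rooted_graph" and Y :: "nat rooted_graph"
  assume "rooted_loc_fin X" "Y \<in> nat_rooted_graphs"
    and "rooted_iso (graph_ball k X) (graph_ball k Y)"
  then show "cluster_at_least k X \<longleftrightarrow> cluster_at_least k Y"
    using rooted_iso_card_verts[of "graph_ball k X" "graph_ball k Y"] rooted_loc_fin_if_nat_rooted
    by (simp add: cluster_at_least_iff_graph_ball)
qed

lemma ball_determined_conj:
  "\<lbrakk>ball_determined m P Q; ball_determined m P' Q'\<rbrakk>
    \<Longrightarrow> ball_determined m (\<lambda>X. P X \<and> P' X) (\<lambda>X. Q X \<and> Q' X)"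
  unfolding ball_determined_def by blast

section \<open>Events in the space of rooted graphs\<close>

definition iso_invariant :: "(nat rooted_graph \<Rightarrow> bool) \<Rightarrow> bool" where
  "iso_invariant Q \<longleftrightarrow>
     (\<forall>X\<in>nat_rooted_graphs. \<forall>Y\<in>nat_rooted_graphs. rooted_iso X Y \<longrightarrow> (Q X \<longleftrightarrow> Q Y))"

lemma iso_invariant_if_ball_determined:
  assumes "ball_determined m Q Q"
  shows "iso_invariant Q"
  unfolding iso_invariant_def
proof (intro ballI impI)
  fix X Y :: "nat rooted_graph"
  assume XY: "X \<in> nat_rooted_graphs" "Y \<in> nat_rooted_graphs" "rooted_iso X Y"
  then show "Q X \<longleftrightarrow> Q Y"
    using rooted_iso_graph_ball[of X Y m] rooted_loc_fin_if_nat_rooted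
    by (intro ball_determinedD[OF assms]) (auto simp: rooted_loc_fin_def split_beta)
qed

abbreviation iso_class_of :: "nat rooted_graph \<Rightarrow> nat rooted_graph set" where
  "iso_class_of Y \<equiv> rooted_iso_rel `` {Y}"

lemma iso_class_of_in_event_iff:
  assumes "iso_invariant Q" "Y \<in> nat_rooted_graphs"
  shows "iso_class_of Y \<in> event Q \<longleftrightarrow> Q Y"
proof -
  have "iso_class_of Y \<in> G_star" unfolding G_star_def using assms(2) by (rule quotientI)
  moreover have "Y \<in> iso_class_of Y"
    using equiv_class_self[OF equiv_rooted_iso_rel assms(2)] .
  moreover have "Q Z \<longleftrightarrow> Q Y" if "Z \<in> iso_class_of Y" for Z
  proof -
    have "Z \<in> nat_rooted_graphs" "rooted_iso Y Z"
      using that unfolding rooted_iso_rel_def by blast+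
    then show ?thesis using assms unfolding iso_invariant_def by blast
  qed
  ultimately show ?thesis unfolding event_def by blast
qed

lemma event_subset_G_star: "event Q \<subseteq> G_star"
  by (auto simp: event_def)

lemma G_star_cases:
  assumes "X \<in> G_star"
  obtains Y where "Y \<in> nat_rooted_graphs" "X = iso_class_of Y"
  using assms unfolding G_star_def by (rule quotientE)

lemma event_eqI:
  assumes "S \<subseteq> G_star" "iso_invariant Q"
    and "\<And>Y. Y \<in> nat_rooted_graphs \<Longrightarrow> iso_class_of Y \<in> S \<longleftrightarrow> Q Y"
  shows "event Q = S"
proof (rule set_eqI)
  fix X
  show "X \<in> event Q \<longleftrightarrow> X \<in> S"
  proof (cases "X \<in> G_star")
    case True
    then show ?thesis by (metis G_star_cases assms(2,3) iso_class_of_in_event_iff)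
  qed (use assms(1) event_subset_G_star in blast)
qed

lemma iso_class_iff_eq_iso_class_of:
  assumes "Y \<in> nat_rooted_graphs" "K \<in> G_star"
  shows "Y \<simeq>\<^sub>\<star> K \<longleftrightarrow> K = iso_class_of Y"
proof -
  obtain Z where Z: "Z \<in> nat_rooted_graphs" "K = iso_class_of Z"
    using assms(2) by (rule G_star_cases)
  have "K = iso_class_of Y \<longleftrightarrow> (Y, Z) \<in> rooted_iso_rel"
    using Z eq_equiv_class_iff[OF equiv_rooted_iso_rel] assms(1) by metis
  also have "\<dots> \<longleftrightarrow> Y \<in> K"
    unfolding Z(2) using equiv_rooted_iso_rel unfolding equiv_def sym_def by blast
  also have "\<dots> \<longleftrightarrow> Y \<simeq>\<^sub>\<star> K"
  proof
    assume "Y \<in> K"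
    moreover have "rooted_iso Y Y"
      using equiv_class_self[OF equiv_rooted_iso_rel assms(1)] unfolding rooted_iso_rel_def by blast
    ultimately show "Y \<simeq>\<^sub>\<star> K" unfolding iso_class_def by blast
  next
    assume "Y \<simeq>\<^sub>\<star> K"
    then obtain W where W: "W \<in> K" "rooted_iso Y W" unfolding iso_class_def by blast
    then have "(Z, W) \<in> rooted_iso_rel" unfolding Z(2) by blast
    moreover from this have "(Y, W) \<in> rooted_iso_rel"
      using W(2) assms(1) unfolding rooted_iso_rel_def by blast
    ultimately show "Y \<in> K" unfolding Z(2)
      using equiv_rooted_iso_rel unfolding equiv_def sym_def trans_def by blast
  qed
  finally show ?thesis by simp
qed

lemma iso_class_unique:
  assumes "X \<simeq>\<^sub>\<star> K" "X \<simeq>\<^sub>\<star> L" "K \<in> G_star" "L \<in> G_star" "snd X \<in> verts (fst X)"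
  shows "K = L"
proof -
  obtain Y where Y: "Y \<in> K" "rooted_iso X Y" using assms(1) unfolding iso_class_def by blast
  obtain Z where "K = iso_class_of Z" using assms(3) by (rule G_star_cases)
  then have Yn: "Y \<in> nat_rooted_graphs"
    using Y(1) unfolding rooted_iso_rel_def by blast
  have "Y \<simeq>\<^sub>\<star> K" "Y \<simeq>\<^sub>\<star> L"
    using iso_class_cong[OF Y(2) assms(5)] assms(1,2) by auto
  then show ?thesis using iso_class_iff_eq_iso_class_of[OF Yn] assms(3,4) by metis
qed

abbreviation ball_event :: "nat \<Rightarrow> nat rooted_graph set \<Rightarrow> nat rooted_graph set set" where
  "ball_event m K \<equiv> event (\<lambda>X. graph_ball m X \<simeq>\<^sub>\<star> K)"

definition ball_classes :: "nat \<Rightarrow> (nat rooted_graph \<Rightarrow> bool) \<Rightarrow> nat rooted_graph set set" where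
  "ball_classes m Q = {iso_class_of (graph_ball m Y) | Y. Y \<in> nat_rooted_graphs \<and> Q Y}"

lemma ball_classes_subset_G_star: "ball_classes m Q \<subseteq> G_star"
  unfolding ball_classes_def G_star_def
  using quotientI[OF graph_ball_in_nat_rooted_graphs] by blast

text \<open>A ball is a finite graph on natural numbers, so it is coded by a number and finitely many finite sets
of numbers. Countability makes events determined by balls measurable, and lets finitely many classes
carry almost all of their mass.\<close>

lemma countable_ball_classes: "countable (ball_classes m Q)"
proof -
  let ?S = "{Y \<in> nat_rooted_graphs. finite (verts (fst Y))}"
  let ?code = "\<lambda>Y :: nat rooted_graph. (verts (fst Y), edges (fst Y), snd Y)"
  have inj: "inj_on ?code ?S"
    by (auto simp: inj_on_def intro!: graph.equality)
  have img: "?code ` ?S \<subseteq> Collect finite \<times> {E. finite E \<and> E \<subseteq> Collect finite} \<times> UNIV"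
  proof (rule image_subsetI)
    fix Y :: "nat rooted_graph" assume Y: "Y \<in> ?S"
    then have fin: "finite (verts (fst Y))" by blast
    have "simple_graph (fst Y)"
      using rooted_loc_fin_if_nat_rooted[of Y] Y by (simp add: rooted_loc_fin_def split_beta)
    then have sub: "edges (fst Y) \<subseteq> Pow (verts (fst Y))" unfolding simple_graph_def by fastforce
    then have "finite (edges (fst Y))" using fin by (simp add: finite_subset)
    moreover have "edges (fst Y) \<subseteq> Collect finite"
      using sub fin finite_subset by blast
    ultimately show "?code Y \<in> Collect finite \<times> {E. finite E \<and> E \<subseteq> Collect finite} \<times> UNIV"
      using fin by simp
  qed
  have cnt: "countable (Collect finite \<times> {E. finite E \<and> E \<subseteq> Collect finite} \<times> UNIV
      :: (nat set \<times> nat set set \<times> nat) set)"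
    by (rule countable_SIGMA[OF countable_Collect_finite
          countable_SIGMA[OF countable_Collect_finite_subset[OF countable_Collect_finite] countableI_type]])
  have "countable ?S"
    using inj countable_subset[OF img cnt] by (rule countable_image_inj_on[rotated])
  have "ball_classes m Q \<subseteq> iso_class_of ` ?S"
  proof
    fix K assume "K \<in> ball_classes m Q"
    then obtain Y where Y: "Y \<in> nat_rooted_graphs" "K = iso_class_of (graph_ball m Y)"
      unfolding ball_classes_def by blast
    have "graph_ball m Y \<in> ?S"
      using graph_ball_in_nat_rooted_graphs[OF Y(1)]
        finite_graph_ball[OF rooted_loc_fin_if_nat_rooted[OF Y(1)]] by simp
    then show "K \<in> iso_class_of ` ?S" unfolding Y(2) by (rule imageI)
  qed
  then show ?thesis using countable_image[OF \<open>countable ?S\<close>] by (rule countable_subset)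
qed

lemma iso_invariant_ball: "iso_invariant (\<lambda>X. graph_ball m X \<simeq>\<^sub>\<star> K)"
  using iso_invariant_if_ball_determined[OF ball_determined_graph_ball] .

lemma iso_class_of_in_ball_event_iff:
  assumes "Y \<in> nat_rooted_graphs" "K \<in> G_star"
  shows "iso_class_of Y \<in> ball_event m K \<longleftrightarrow> K = iso_class_of (graph_ball m Y)"
  using iso_class_of_in_event_iff[OF iso_invariant_ball assms(1)]
    iso_class_iff_eq_iso_class_of[OF graph_ball_in_nat_rooted_graphs[OF assms(1)] assms(2)] by simp

text \<open>If two rooted graphs have isomorphic balls of radius \<open>m\<close> and \<open>Q\<close> holds for one of them, it holds for
the other. So the union over the classes that are possible under \<open>Q\<close> adds no graph violating \<open>Q\<close>.\<close>

lemma event_eq_UN_ball_event: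
  assumes "ball_determined m Q Q"
  shows "event Q = (\<Union>K\<in>ball_classes m Q. ball_event m K)"
proof (rule event_eqI)
  show "(\<Union>K\<in>ball_classes m Q. ball_event m K) \<subseteq> G_star"
    using event_subset_G_star by blast
  show "iso_invariant Q" using assms by (rule iso_invariant_if_ball_determined)
  fix Y assume Y: "Y \<in> nat_rooted_graphs"
  have "iso_class_of Y \<in> (\<Union>K\<in>ball_classes m Q. ball_event m K)
      \<longleftrightarrow> (\<exists>K\<in>ball_classes m Q. K = iso_class_of (graph_ball m Y))"
    using iso_class_of_in_ball_event_iff[OF Y] ball_classes_subset_G_star by (simp add: subset_iff)
  also have "\<dots> \<longleftrightarrow> Q Y"
  proof
    assume "\<exists>K\<in>ball_classes m Q. K = iso_class_of (graph_ball m Y)"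
    then have "iso_class_of (graph_ball m Y) \<in> ball_classes m Q" by simp
    then obtain Z where Z: "Z \<in> nat_rooted_graphs" "Q Z"
      "iso_class_of (graph_ball m Y) = iso_class_of (graph_ball m Z)"
      unfolding ball_classes_def by blast
    then have "(graph_ball m Y, graph_ball m Z) \<in> rooted_iso_rel"
      by (intro eq_equiv_class[OF Z(3) equiv_rooted_iso_rel] graph_ball_in_nat_rooted_graphs Z(1))
    then have "rooted_iso (graph_ball m Y) (graph_ball m Z)"
      unfolding rooted_iso_rel_def by blast
    then show "Q Y"
      using ball_determinedD[OF assms rooted_loc_fin_if_nat_rooted[OF Y] Z(1)] Z(2) by blast
  next
    assume "Q Y"
    then have "iso_class_of (graph_ball m Y) \<in> ball_classes m Q"
      unfolding ball_classes_def using Y by blast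
    then show "\<exists>K\<in>ball_classes m Q. K = iso_class_of (graph_ball m Y)" by blast
  qed
  finally show "iso_class_of Y \<in> (\<Union>K\<in>ball_classes m Q. ball_event m K) \<longleftrightarrow> Q Y" .
qed

lemma disjoint_ball_event:
  assumes "F \<subseteq> G_star"
  shows "disjoint_family_on (ball_event m) F"
proof (unfold disjoint_family_on_def, intro ballI impI)
  fix K L assume KL: "K \<in> F" "L \<in> F" "K \<noteq> L"
  have False if "X \<in> ball_event m K" "X \<in> ball_event m L" for X
  proof -
    have "X \<in> G_star" using that(1) event_subset_G_star by blast
    then obtain Y where Y: "Y \<in> nat_rooted_graphs" "X = iso_class_of Y" by (rule G_star_cases)
    have "K \<in> G_star" "L \<in> G_star" using KL assms by blast+
    then show False
      using that KL(3) iso_class_of_in_ball_event_iff[OF Y(1)] unfolding Y(2) by simp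
  qed
  then show "ball_event m K \<inter> ball_event m L = {}" by blast
qed

text \<open>An event only asks for some representative of the class with the property, which behaves well under
complements and intersections once all representatives agree.\<close>

lemma event_Not:
  assumes "iso_invariant Q"
  shows "event (\<lambda>X. \<not> Q X) = G_star - event Q"
proof (rule event_eqI)
  fix Y assume "Y \<in> nat_rooted_graphs"
  then show "iso_class_of Y \<in> G_star - event Q \<longleftrightarrow> \<not> Q Y"
    using assms iso_class_of_in_event_iff[of Q Y] by (simp add: G_star_def quotientI)
qed (use assms in \<open>auto simp: iso_invariant_def\<close>)

lemma event_All:
  assumes "\<And>k. iso_invariant (Q k)"
  shows "event (\<lambda>X. \<forall>k::nat. Q k X) = (\<Inter>k. event (Q k))"
proof (rule event_eqI)
  fix Y assume "Y \<in> nat_rooted_graphs"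
  then show "iso_class_of Y \<in> (\<Inter>k. event (Q k)) \<longleftrightarrow> (\<forall>k. Q k Y)"
    using assms iso_class_of_in_event_iff[of _ Y] by simp
next
  show "(\<Inter>k. event (Q k)) \<subseteq> G_star" using event_subset_G_star by blast
  show "iso_invariant (\<lambda>X. \<forall>k. Q k X)" using assms unfolding iso_invariant_def by blast
qed

lemma space_local_borel: "space local_borel = G_star"
  unfolding local_borel_def using event_subset_G_star by (intro space_measure_of) blast

lemma ball_event_in_sets: "K \<in> G_star \<Longrightarrow> ball_event m K \<in> sets local_borel"
  unfolding local_borel_def using event_subset_G_star
  by (intro in_measure_of) blast+

lemma event_in_sets:
  assumes "ball_determined m Q Q"
  shows "event Q \<in> sets local_borel"
  unfolding event_eq_UN_ball_event[OF assms]
  using ball_classes_subset_G_star[of m Q]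
  by (intro sets.countable_UN' countable_ball_classes image_subsetI ball_event_in_sets) blast

lemma (in finite_measure) finite_subunion_approx:
  assumes "countable C" "\<And>i. i \<in> C \<Longrightarrow> A i \<in> sets M" "\<epsilon> > 0"
  obtains F where "finite F" "F \<subseteq> C" "measure M (\<Union>i\<in>C. A i) - \<epsilon> \<le> measure M (\<Union>i\<in>F. A i)"
proof (cases "C = {}")
  case True
  then show ?thesis using that[of "{}"] assms(3) by simp
next
  case False
  let ?B = "\<lambda>n. \<Union>i\<in>from_nat_into C ` {..<n}. A i"
  have in_C: "from_nat_into C i \<in> C" for i using from_nat_into[OF False] .
  have "(\<lambda>n. measure M (?B n)) \<longlonglongrightarrow> measure M (\<Union>n. ?B n)"
    using assms(2) in_C by (intro finite_Lim_measure_incseq) (fastforce simp: incseq_def)+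
  moreover have "(\<Union>n. ?B n) = (\<Union>i\<in>C. A i)"
  proof -
    have "(\<Union>n. ?B n) = (\<Union>i\<in>range (from_nat_into C). A i)" by blast
    then show ?thesis by (simp only: range_from_nat_into[OF False assms(1)])
  qed
  ultimately have "(\<lambda>n. measure M (?B n)) \<longlonglongrightarrow> measure M (\<Union>i\<in>C. A i)" by simp
  then have "\<forall>\<^sub>F n in sequentially. measure M (\<Union>i\<in>C. A i) - \<epsilon> < measure M (?B n)"
    using assms(3) by (intro order_tendstoD(1)) auto
  then obtain n where "measure M (\<Union>i\<in>C. A i) - \<epsilon> < measure M (?B n)"
    by (auto simp: eventually_sequentially)
  then show ?thesis using that[of "from_nat_into C ` {..<n}"] in_C by auto
qed

section \<open>Bounds outside small exceptional events\<close>

text \<open>For all large \<open>n\<close>, the property holds with probability at least \<open>1 - \<delta>\<close>, in a form that requires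
only the exceptional set to be measurable, not the set where \<open>P\<close> holds. A functional of the random graph together with its largest
component need not be measurable, since a \<open>\<sigma>\<close>-algebra generated by two discrete ones can be
strictly smaller than the discrete one on the product. Unlike \<open>tendsto_in_prob\<close>, this notion passes
to weaker properties and to conjunctions without any measurability of \<open>P\<close>.\<close>

definition eventually_outside ::
    "(nat \<Rightarrow> 'a measure) \<Rightarrow> real \<Rightarrow> (nat \<Rightarrow> 'a \<Rightarrow> bool) \<Rightarrow> bool" where
  "eventually_outside M \<delta> P \<longleftrightarrow> (\<forall>\<^sub>F n in sequentially.
     \<exists>B\<in>sets (M n). measure (M n) B \<le> \<delta> \<and> (\<forall>\<omega>\<in>space (M n) - B. P n \<omega>))"

lemma eventually_outside_mono:
  assumes "eventually_outside M \<delta> P"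
    and "\<And>n \<omega>. \<lbrakk>n \<ge> 1; \<omega> \<in> space (M n); P n \<omega>\<rbrakk> \<Longrightarrow> Q n \<omega>"
  shows "eventually_outside M \<delta> Q"
  using assms(1) eventually_ge_at_top[of 1] unfolding eventually_outside_def
  by eventually_elim (use assms(2) in blast)

lemma eventually_outside_conj:
  assumes "eventually_outside M \<delta> P" "eventually_outside M \<delta>' Q"
  shows "eventually_outside M (\<delta> + \<delta>') (\<lambda>n \<omega>. P n \<omega> \<and> Q n \<omega>)"
  using assms unfolding eventually_outside_def
proof eventually_elim
  case (elim n)
  then obtain A B where A: "A \<in> sets (M n)" "measure (M n) A \<le> \<delta>" "\<forall>\<omega>\<in>space (M n) - A. P n \<omega>"
    and B: "B \<in> sets (M n)" "measure (M n) B \<le> \<delta>'" "\<forall>\<omega>\<in>space (M n) - B. Q n \<omega>" by blast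
  have "measure (M n) (A \<union> B) \<le> \<delta> + \<delta>'"
    using measure_Un_le[OF A(1) B(1)] A(2) B(2) by simp
  then show ?case using A B by (intro bexI[of _ "A \<union> B"]) auto
qed

lemma eventually_outside_Ball:
  assumes "finite F" "\<And>i \<delta>. \<lbrakk>i \<in> F; \<delta> > 0\<rbrakk> \<Longrightarrow> eventually_outside M \<delta> (P i)" "\<delta> > 0"
  shows "eventually_outside M \<delta> (\<lambda>n \<omega>. \<forall>i\<in>F. P i n \<omega>)"
  using assms
proof (induction F arbitrary: \<delta> rule: finite_induct)
  case empty
  then show ?case
    unfolding eventually_outside_def by (intro always_eventually allI bexI[of _ "{}"]) auto
next
  case (insert i F)
  have "eventually_outside M (\<delta> / 2 + \<delta> / 2) (\<lambda>n \<omega>. P i n \<omega> \<and> (\<forall>i\<in>F. P i n \<omega>))"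
    using insert by (intro eventually_outside_conj) auto
  then show ?case by simp
qed

lemma eventually_outside_if_tendsto_in_prob:
  assumes "tendsto_in_prob M X c" "\<And>n. n \<ge> 1 \<Longrightarrow> X n \<in> borel_measurable (M n)" "\<epsilon> > 0" "\<delta> > 0"
  shows "eventually_outside M \<delta> (\<lambda>n \<omega>. \<bar>X n \<omega> - c\<bar> \<le> \<epsilon>)"
proof -
  have "(\<lambda>n. \<P>(\<omega> in M n. \<bar>X n \<omega> - c\<bar> > \<epsilon>)) \<longlonglongrightarrow> 0"
    using assms(1,3) unfolding tendsto_in_prob_def by blast
  then have "\<forall>\<^sub>F n in sequentially. \<P>(\<omega> in M n. \<bar>X n \<omega> - c\<bar> > \<epsilon>) < \<delta>"
    using assms(4) by (rule order_tendstoD(2))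
  then show ?thesis
    using eventually_ge_at_top[of 1] unfolding eventually_outside_def
  proof eventually_elim
    case (elim n)
    have [measurable]: "X n \<in> borel_measurable (M n)" using assms(2) elim by blast
    show ?case
      using elim(1) by (intro bexI[of _ "{\<omega> \<in> space (M n). \<bar>X n \<omega> - c\<bar> > \<epsilon>}"]) auto
  qed
qed

text \<open>The deviation set may fail to be measurable, but then its \<open>measure\<close> is 0 by convention, so
monotonicity needs only the measurability of the exceptional set containing it.\<close>

lemma tendsto_in_probI:
  assumes "\<And>n. n \<ge> 1 \<Longrightarrow> prob_space (M n)"
    and "\<And>\<epsilon> \<delta>. \<lbrakk>\<epsilon> > 0; \<delta> > 0\<rbrakk> \<Longrightarrow> eventually_outside M \<delta> (\<lambda>n \<omega>. \<bar>X n \<omega> - c\<bar> \<le> \<epsilon>)"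
  shows "tendsto_in_prob M X c"
  unfolding tendsto_in_prob_def
proof (intro allI impI)
  fix \<epsilon> :: real assume "\<epsilon> > 0"
  show "(\<lambda>n. \<P>(\<omega> in M n. \<bar>X n \<omega> - c\<bar> > \<epsilon>)) \<longlonglongrightarrow> 0"
  proof (rule tendstoI)
    fix \<delta> :: real assume "\<delta> > 0"
    then have "eventually_outside M (\<delta> / 2) (\<lambda>n \<omega>. \<bar>X n \<omega> - c\<bar> \<le> \<epsilon>)"
      using assms(2) \<open>\<epsilon> > 0\<close> by simp
    then show "\<forall>\<^sub>F n in sequentially. dist (\<P>(\<omega> in M n. \<bar>X n \<omega> - c\<bar> > \<epsilon>)) 0 < \<delta>"
      using eventually_ge_at_top[of 1] unfolding eventually_outside_def
    proof eventually_elim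
      case (elim n)
      then obtain B where B: "B \<in> sets (M n)" "measure (M n) B \<le> \<delta> / 2"
        "\<forall>\<omega>\<in>space (M n) - B. \<bar>X n \<omega> - c\<bar> \<le> \<epsilon>" by blast
      interpret prob_space "M n" using assms(1) elim by blast
      have "{\<omega> \<in> space (M n). \<bar>X n \<omega> - c\<bar> > \<epsilon>} \<subseteq> B" using B(3) by force
      then have "\<P>(\<omega> in M n. \<bar>X n \<omega> - c\<bar> > \<epsilon>) \<le> measure (M n) B"
        using B(1) by (rule finite_measure_mono)
      then show ?case using B(2) \<open>\<delta> > 0\<close> by simp
    qed
  qed
qed

section \<open>Convergence of vertex fractions\<close>

definition vertex_fraction :: "('v rooted_graph \<Rightarrow> bool) \<Rightarrow> 'v graph \<Rightarrow> real" where
  "vertex_fraction P K = 1 / real (card (verts K)) * (\<Sum>v\<in>verts K. of_bool (P (K, v)))"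

lemma vertex_fraction_Not:
  assumes "finite (verts K)" "verts K \<noteq> {}"
  shows "vertex_fraction (\<lambda>X. \<not> P X) K = 1 - vertex_fraction P K"
proof -
  have "(\<Sum>v\<in>verts K. of_bool (\<not> P (K, v))) + (\<Sum>v\<in>verts K. of_bool (P (K, v)))
      = (\<Sum>v\<in>verts K. 1 :: real)"
    unfolding sum.distrib[symmetric] by (intro sum.cong) auto
  then have "(\<Sum>v\<in>verts K. of_bool (\<not> P (K, v)))
      = real (card (verts K)) - (\<Sum>v\<in>verts K. of_bool (P (K, v)))" by simp
  then show ?thesis
    unfolding vertex_fraction_def using assms by (simp add: field_simps)
qed

text \<open>A vertex is counted at most once on the left, as its ball has at most one isomorphism class.\<close>

lemma sum_vertex_fraction_ball_le:
  assumes "finite F" "F \<subseteq> G_star" "simple_graph K" "locally_finite K"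
    and "\<And>v L. \<lbrakk>v \<in> verts K; L \<in> F; graph_ball m (K, v) \<simeq>\<^sub>\<star> L\<rbrakk> \<Longrightarrow> P (K, v)"
  shows "(\<Sum>L\<in>F. vertex_fraction (\<lambda>X. graph_ball m X \<simeq>\<^sub>\<star> L) K) \<le> vertex_fraction P K"
proof -
  have "(\<Sum>L\<in>F. of_bool (graph_ball m (K, v) \<simeq>\<^sub>\<star> L) :: real) \<le> of_bool (P (K, v))"
    if v: "v \<in> verts K" for v
  proof -
    have wf: "rooted_loc_fin (K, v)" using assms(3,4) v by (simp add: rooted_loc_fin_def)
    have "(\<Sum>L\<in>F. of_bool (graph_ball m (K, v) \<simeq>\<^sub>\<star> L)) = real (card {L\<in>F. graph_ball m (K, v) \<simeq>\<^sub>\<star> L})"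
      using assms(1) by (simp add: sum_of_bool_eq Int_def)
    moreover have "card {L\<in>F. graph_ball m (K, v) \<simeq>\<^sub>\<star> L} \<le> Suc 0"
    proof (subst card_le_Suc0_iff_eq, use assms(1) in simp, intro ballI)
      fix L L' assume "L \<in> {L\<in>F. graph_ball m (K, v) \<simeq>\<^sub>\<star> L}" "L' \<in> {L\<in>F. graph_ball m (K, v) \<simeq>\<^sub>\<star> L}"
      then show "L = L'"
        using iso_class_unique[of "graph_ball m (K, v)" L L'] root_in_graph_ball[OF wf, of m]
          subsetD[OF assms(2)] by simp
    qed
    moreover have "card {L\<in>F. graph_ball m (K, v) \<simeq>\<^sub>\<star> L} = 0" if "\<not> P (K, v)"
    proof -
      have "{L\<in>F. graph_ball m (K, v) \<simeq>\<^sub>\<star> L} = {}" using assms(5)[OF v] that by blast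
      then show ?thesis by (simp only: card.empty)
    qed
    ultimately show ?thesis by (cases "P (K, v)") simp_all
  qed
  then have "(\<Sum>v\<in>verts K. \<Sum>L\<in>F. of_bool (graph_ball m (K, v) \<simeq>\<^sub>\<star> L) :: real)
      \<le> (\<Sum>v\<in>verts K. of_bool (P (K, v)))" by (rule sum_mono)
  then show ?thesis
    unfolding vertex_fraction_def sum_distrib_left[symmetric] sum.swap[of _ _ F]
    by (intro mult_left_mono) auto
qed

locale local_limit =
  fixes M :: "nat \<Rightarrow> 'a measure"
    and G :: "nat \<Rightarrow> 'a \<Rightarrow> 'v graph"
    and \<mu> :: "nat rooted_graph set measure"
  assumes random: "\<And>n. n \<ge> 1 \<Longrightarrow> random_graph (M n) (G n)"
    and card_verts: "\<And>n \<omega>. n \<ge> 1 \<Longrightarrow> \<omega> \<in> space (M n) \<Longrightarrow> card (verts (G n \<omega>)) = n"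
    and prob_limit: "prob_space \<mu>"
    and sets_limit: "sets \<mu> = sets local_borel"
    and local_conv: "tendsto_locally_in_prob M G \<mu>"
begin

sublocale limit: prob_space \<mu> by (rule prob_limit)

lemma space_limit: "space \<mu> = G_star"
  using sets_eq_imp_space_eq[OF sets_limit] by (simp add: space_local_borel)

lemma measurable_functional:
  assumes "n \<ge> 1"
  shows "(\<lambda>\<omega>. f (G n \<omega>) :: real) \<in> borel_measurable (M n)"
  using random[OF assms] unfolding random_graph_def
  by (auto intro: measurable_compose[of _ _ "count_space UNIV"])

lemma graph_props:
  assumes "n \<ge> 1" "\<omega> \<in> space (M n)"
  shows "simple_graph (G n \<omega>)" "locally_finite (G n \<omega>)" "finite (verts (G n \<omega>))"
    "verts (G n \<omega>) \<noteq> {}"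
  using random[OF assms(1)] assms card_verts[OF assms]
  by (auto simp: random_graph_def intro: card_ge_0_finite)

text \<open>Only a lower bound survives the restriction to finitely many classes: vertices whose balls have one of
the remaining classes are ignored.\<close>

lemma vertex_fraction_lower:
  assumes PQ: "ball_determined m P Q" and QQ: "ball_determined m Q Q" and "\<epsilon> > 0" "\<delta> > 0"
  shows "eventually_outside M \<delta> (\<lambda>n \<omega>. measure \<mu> (event Q) - \<epsilon> \<le> vertex_fraction P (G n \<omega>))"
proof -
  let ?C = "ball_classes m Q"
  have C: "?C \<subseteq> G_star" by (rule ball_classes_subset_G_star)
  have meas: "ball_event m L \<in> sets \<mu>" if "L \<in> ?C" for L
    using that C ball_event_in_sets sets_limit by blast
  obtain F where F: "finite F" "F \<subseteq> ?C"
    "measure \<mu> (\<Union>L\<in>?C. ball_event m L) - \<epsilon> / 2 \<le> measure \<mu> (\<Union>L\<in>F. ball_event m L)"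
    using limit.finite_subunion_approx[OF countable_ball_classes[of m Q], of "ball_event m" "\<epsilon> / 2"]
      meas \<open>\<epsilon> > 0\<close> by auto
  have FG: "F \<subseteq> G_star" using F(2) C by blast
  have "measure \<mu> (\<Union>L\<in>F. ball_event m L) = (\<Sum>L\<in>F. measure \<mu> (ball_event m L))"
    using F(1,2) meas disjoint_ball_event[OF FG]
    by (intro limit.finite_measure_finite_Union) auto
  then have mass: "measure \<mu> (event Q) - \<epsilon> / 2 \<le> (\<Sum>L\<in>F. measure \<mu> (ball_event m L))"
    using F(3) by (simp add: event_eq_UN_ball_event[OF QQ])
  \<comment> \<open>Half of \<open>\<epsilon>\<close> is spent on the classes outside \<open>F\<close>, the other half is shared by those in \<open>F\<close>;
    the summand 1 avoids division by 0 for empty \<open>F\<close>.\<close>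
  define \<eta> where "\<eta> = \<epsilon> / (2 * real (card F + 1))"
  have "\<eta> > 0" and \<eta>: "real (card F) * \<eta> \<le> \<epsilon> / 2"
    using \<open>\<epsilon> > 0\<close> by (auto simp: \<eta>_def field_simps)
  have "eventually_outside M \<delta> (\<lambda>n \<omega>. \<forall>L\<in>F.
      \<bar>vertex_fraction (\<lambda>X. graph_ball m X \<simeq>\<^sub>\<star> L) (G n \<omega>) - measure \<mu> (ball_event m L)\<bar> \<le> \<eta>)"
  proof (rule eventually_outside_Ball[OF F(1) _ \<open>\<delta> > 0\<close>])
    fix L and \<delta>' :: real assume "L \<in> F" "\<delta>' > 0"
    have "tendsto_in_prob M (\<lambda>n \<omega>. vertex_fraction (\<lambda>X. graph_ball m X \<simeq>\<^sub>\<star> L) (G n \<omega>))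
        (measure \<mu> (ball_event m L))"
      using local_conv FG \<open>L \<in> F\<close> unfolding tendsto_locally_in_prob_def vertex_fraction_def by blast
    then show "eventually_outside M \<delta>' (\<lambda>n \<omega>.
        \<bar>vertex_fraction (\<lambda>X. graph_ball m X \<simeq>\<^sub>\<star> L) (G n \<omega>) - measure \<mu> (ball_event m L)\<bar> \<le> \<eta>)"
      using measurable_functional \<open>\<eta> > 0\<close> \<open>\<delta>' > 0\<close>
      by (intro eventually_outside_if_tendsto_in_prob)
  qed
  then show ?thesis
  proof (rule eventually_outside_mono)
    fix n \<omega> assume n: "n \<ge> 1" "\<omega> \<in> space (M n)"
      and close: "\<forall>L\<in>F. \<bar>vertex_fraction (\<lambda>X. graph_ball m X \<simeq>\<^sub>\<star> L) (G n \<omega>)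
        - measure \<mu> (ball_event m L)\<bar> \<le> \<eta>"
    note G = graph_props[OF n]
    have "(\<Sum>L\<in>F. measure \<mu> (ball_event m L) - \<eta>)
        \<le> (\<Sum>L\<in>F. vertex_fraction (\<lambda>X. graph_ball m X \<simeq>\<^sub>\<star> L) (G n \<omega>))"
      using close by (intro sum_mono) (auto simp: abs_le_iff)
    also have "\<dots> \<le> vertex_fraction P (G n \<omega>)"
    proof (rule sum_vertex_fraction_ball_le[OF F(1) FG G(1,2)])
      fix v L assume v: "v \<in> verts (G n \<omega>)" and L: "L \<in> F" "graph_ball m (G n \<omega>, v) \<simeq>\<^sub>\<star> L"
      then obtain Y where Y: "Y \<in> nat_rooted_graphs" "Q Y" "L = iso_class_of (graph_ball m Y)"
        using F(2) unfolding ball_classes_def by blast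
      from L(2) obtain Z where Z: "Z \<in> L" "rooted_iso (graph_ball m (G n \<omega>, v)) Z"
        unfolding iso_class_def by blast
      have "rooted_iso Z (graph_ball m Y)"
        using Z(1) equiv_rooted_iso_rel unfolding Y(3) equiv_def sym_def rooted_iso_rel_def by blast
      with Z(2) have "rooted_iso (graph_ball m (G n \<omega>, v)) (graph_ball m Y)"
        by (rule rooted_iso_trans)
      moreover have "rooted_loc_fin (G n \<omega>, v)" using G(1,2) v by (simp add: rooted_loc_fin_def)
      ultimately show "P (G n \<omega>, v)" using ball_determinedD[OF PQ _ Y(1)] Y(2) by blast
    qed
    finally show "measure \<mu> (event Q) - \<epsilon> \<le> vertex_fraction P (G n \<omega>)"
      using mass \<eta> by (simp add: sum_subtractf)
  qed
qed

text \<open>The random balls cannot lose mass to ever larger classes: the fractions of a property and of its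
negation add up to 1, and so do the limits that bound them from below.\<close>

lemma vertex_fraction_close:
  assumes PQ: "ball_determined m P Q" and QQ: "ball_determined m Q Q" and "\<epsilon> > 0" "\<delta> > 0"
  shows "eventually_outside M \<delta> (\<lambda>n \<omega>. \<bar>vertex_fraction P (G n \<omega>) - measure \<mu> (event Q)\<bar> \<le> \<epsilon>)"
proof -
  have compl: "measure \<mu> (event (\<lambda>X. \<not> Q X)) = 1 - measure \<mu> (event Q)"
    using limit.prob_compl[of "event Q"] event_in_sets[OF QQ] sets_limit
      event_Not[OF iso_invariant_if_ball_determined[OF QQ]] space_limit by simp
  have "eventually_outside M (\<delta> / 2 + \<delta> / 2) (\<lambda>n \<omega>.
      measure \<mu> (event Q) - \<epsilon> \<le> vertex_fraction P (G n \<omega>) \<and>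
      measure \<mu> (event (\<lambda>X. \<not> Q X)) - \<epsilon> \<le> vertex_fraction (\<lambda>X. \<not> P X) (G n \<omega>))"
    using assms
    by (intro eventually_outside_conj vertex_fraction_lower[of m] ball_determined_Not) auto
  then show ?thesis
    unfolding compl field_sum_of_halves
    by (rule eventually_outside_mono) (simp add: vertex_fraction_Not graph_props abs_le_iff)
qed

end

section \<open>Large components and the largest component\<close>

definition large_pairs :: "nat \<Rightarrow> 'v graph \<Rightarrow> ('v \<times> 'v) set" where
  "large_pairs k K = {(x, y). x \<in> verts K \<and> y \<in> verts K \<and> card (cluster K x) \<ge> k \<and>
     card (cluster K y) \<ge> k \<and> x \<notin> cluster K y}"

lemma cluster_eq_if_mem:
  assumes "v \<in> cluster K w"
  shows "cluster K v = cluster K w"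
proof -
  have "(w, v) \<in> (adj K)\<^sup>*" using assms by (simp add: cluster_def)
  moreover from this have "(v, w) \<in> (adj K)\<^sup>*" using sym_rtrancl[OF sym_adj] by (rule symD[rotated])
  ultimately show ?thesis unfolding cluster_def by (auto intro: rtrancl_trans)
qed

text \<open>Count the pairs by their second entry \<open>y\<close>: it is paired with everything in \<open>L\<close> outside its own
component, and that component has at most \<open>card C\<close> vertices.\<close>

lemma card_large_pairs_ge:
  fixes k :: nat
  assumes fin: "finite (verts K)" and C: "largest_cluster K C"
  defines "L \<equiv> {v \<in> verts K. k \<le> card (cluster K v)}"
  shows "real (card L) * (real (card L) - real (card C)) \<le> real (card (large_pairs k K))"
proof -
  have finL: "finite L" using fin by (simp add: L_def)
  have "bij_betw prod.swap (SIGMA y:L. L - cluster K y) (large_pairs k K)"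
    by (rule bij_betw_byWitness[of _ prod.swap]) (auto simp: large_pairs_def L_def)
  then have "card (large_pairs k K) = card (SIGMA y:L. L - cluster K y)"
    by (simp add: bij_betw_same_card)
  also have "\<dots> = (\<Sum>y\<in>L. card (L - cluster K y))"
    using finL by (intro card_SigmaI) auto
  finally have "real (card (large_pairs k K)) = (\<Sum>y\<in>L. real (card (L - cluster K y)))" by simp
  moreover have "(\<Sum>y\<in>L. real (card L) - real (card C)) \<le> (\<Sum>y\<in>L. real (card (L - cluster K y)))"
  proof (rule sum_mono)
    fix y assume "y \<in> L"
    then have "card (cluster K y) \<le> card C" using C by (simp add: largest_cluster_def L_def)
    moreover have "finite (cluster K y)" using fin by (simp add: cluster_def)
    then have "card L - card (cluster K y) \<le> card (L - cluster K y)"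
      by (rule diff_card_le_card_Diff)
    ultimately show "real (card L) - real (card C) \<le> real (card (L - cluster K y))" by linarith
  qed
  ultimately show ?thesis by simp
qed

lemma largest_cluster_subset_large:
  assumes "largest_cluster K C" "v \<in> verts K" "k \<le> card (cluster K v)"
  shows "C \<subseteq> {u \<in> verts K. k \<le> card (cluster K u)}"
proof
  fix u assume u: "u \<in> C"
  obtain w where "C = cluster K w" using assms(1) by (auto simp: largest_cluster_def)
  then have "u \<in> verts K" "cluster K u = C"
    using u cluster_eq_if_mem[of u K w] by (simp add: cluster_def, simp)
  moreover have "k \<le> card C" using assms by (force simp: largest_cluster_def)
  ultimately show "u \<in> {u \<in> verts K. k \<le> card (cluster K u)}" by simp
qed

text \<open>The difference on the left is at most the fraction of vertices in large components other than \<open>C\<close>.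
Once the large components have linear size, the quadratic bound \<open>card_large_pairs_ge\<close> becomes the linear bound on the right.\<close>

lemma largest_cluster_fraction_close:
  assumes fin: "finite (verts K)" and C: "largest_cluster K C" and "z > 0"
    and z: "z \<le> vertex_fraction (cluster_at_least k) K"
  defines "n \<equiv> real (card (verts K))"
  shows "\<bar>vertex_fraction (\<lambda>X. cluster_at_least k X \<and> R X) K - 1 / n * (\<Sum>v\<in>C. of_bool (R (K, v)))\<bar>
    \<le> (1 / n\<^sup>2 * real (card (large_pairs k K))) / z"
proof -
  define L where "L = {v \<in> verts K. k \<le> card (cluster K v)}"
  have "finite (cluster K v)" for v using fin by (simp add: cluster_def)
  then have large: "cluster_at_least k (K, v) \<longleftrightarrow> k \<le> card (cluster K v)" for v
    by (simp add: cluster_at_least_def)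
  have finL: "finite L" using fin by (simp add: L_def)
  have frac_L: "vertex_fraction (cluster_at_least k) K = real (card L) / n"
    using fin unfolding vertex_fraction_def large n_def L_def
    by (simp add: sum_of_bool_eq Int_def)
  have "n > 0" "card L > 0"
    using z \<open>z > 0\<close> unfolding frac_L
    by (auto simp: n_def intro!: gr0I)
  have "C \<subseteq> L"
    using largest_cluster_subset_large[OF C, of _ k] \<open>card L > 0\<close>
    unfolding L_def by (metis (no_types, lifting) Collect_empty_eq card.empty less_irrefl)
  have "(\<Sum>v\<in>verts K. of_bool (cluster_at_least k (K, v) \<and> R (K, v)))
      = (\<Sum>v\<in>L. of_bool (R (K, v)) :: real)"
    unfolding large L_def using fin
    by (auto simp: sum_of_bool_eq intro!: arg_cong[of _ _ card])
  moreover have "(\<Sum>v\<in>L - C. of_bool (R (K, v)))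
      = (\<Sum>v\<in>L. of_bool (R (K, v)) :: real) - (\<Sum>v\<in>C. of_bool (R (K, v)))"
    using finL \<open>C \<subseteq> L\<close> by (rule sum_diff)
  ultimately have diff: "vertex_fraction (\<lambda>X. cluster_at_least k X \<and> R X) K
      - 1 / n * (\<Sum>v\<in>C. of_bool (R (K, v))) = 1 / n * (\<Sum>v\<in>L - C. of_bool (R (K, v)))"
    unfolding vertex_fraction_def n_def by (simp only: right_diff_distrib)
  have "(\<Sum>v\<in>L - C. of_bool (R (K, v))) \<le> (\<Sum>v\<in>L - C. 1 :: real)"
    by (rule sum_mono) simp
  also have "\<dots> = real (card L) - real (card C)"
    using \<open>C \<subseteq> L\<close> finL by (simp add: card_Diff_subset finite_subset of_nat_diff card_mono)
  also have "\<dots> \<le> real (card (large_pairs k K)) / real (card L)"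
    using card_large_pairs_ge[OF fin C, of k] \<open>card L > 0\<close>
    by (simp add: L_def[symmetric] field_simps)
  also have "\<dots> \<le> real (card (large_pairs k K)) / (z * n)"
    using z \<open>z > 0\<close> \<open>n > 0\<close> \<open>card L > 0\<close> unfolding frac_L
    by (intro divide_left_mono) (auto simp: field_simps)
  finally have "1 / n * (\<Sum>v\<in>L - C. of_bool (R (K, v)))
      \<le> 1 / n * (real (card (large_pairs k K)) / (z * n))"
    using \<open>n > 0\<close> by (intro mult_left_mono) auto
  moreover have "0 \<le> 1 / n * (\<Sum>v\<in>L - C. of_bool (R (K, v)))"
    using \<open>n > 0\<close> by (simp add: sum_nonneg)
  ultimately show ?thesis unfolding diff by (simp add: power2_eq_square field_simps)
qed

lemma event_infinite_cluster_eq: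
  "event (\<lambda>(K, z). infinite (cluster K z) \<and> R (K, z))
     = event (\<lambda>X. \<forall>k. cluster_at_least k X \<and> R X)"
proof -
  have "infinite (cluster K z) \<longleftrightarrow> (\<forall>k. cluster_at_least k (K, z))" for K :: "nat graph" and z
    by (auto simp: cluster_at_least_def dest: spec[of _ "Suc (card (cluster K z))"])
  then show ?thesis by (intro arg_cong[of _ _ event]) auto
qed

context local_limit
begin

text \<open>For fixed \<open>k\<close> the event is determined by a ball; the event of an infinite component need not be, and
its measurability and measure come from the decreasing intersection over \<open>k\<close>.\<close>

lemma measure_large_cluster_tendsto:
  assumes R: "ball_determined r R R"
  shows "(\<lambda>k. measure \<mu> (event (\<lambda>X. cluster_at_least k X \<and> R X)))
    \<longlonglongrightarrow> measure \<mu> (event (\<lambda>(K, z). infinite (cluster K z) \<and> R (K, z)))"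
    and "event (\<lambda>(K, z). infinite (cluster K z) \<and> R (K, z)) \<in> sets \<mu>"
    and "measure \<mu> (event (\<lambda>(K, z). infinite (cluster K z) \<and> R (K, z)))
      \<le> measure \<mu> (event (\<lambda>X. cluster_at_least k X \<and> R X))"
proof -
  let ?Q = "\<lambda>k X. cluster_at_least k X \<and> R X"
  have det: "ball_determined (max r k) (?Q k) (?Q k)" for k
    by (intro ball_determined_conj ball_determined_mono[OF R]
        ball_determined_mono[OF ball_determined_cluster_at_least]) auto
  have eq: "event (\<lambda>(K, z). infinite (cluster K z) \<and> R (K, z)) = (\<Inter>k. event (?Q k))"
    unfolding event_infinite_cluster_eq
    by (rule event_All) (rule iso_invariant_if_ball_determined[OF det])
  have meas: "event (?Q k) \<in> sets \<mu>" for k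
    using event_in_sets[OF det] sets_limit by simp
  have "cluster_at_least j X" if "cluster_at_least k X" "j \<le> k" for j k and X :: "nat rooted_graph"
    using that by (auto simp: cluster_at_least_def split_beta)
  then have "decseq (\<lambda>k. event (?Q k))"
    unfolding decseq_def event_def by blast
  then show "(\<lambda>k. measure \<mu> (event (?Q k)))
    \<longlonglongrightarrow> measure \<mu> (event (\<lambda>(K, z). infinite (cluster K z) \<and> R (K, z)))"
    unfolding eq using meas by (intro limit.finite_Lim_measure_decseq) auto
  show "event (\<lambda>(K, z). infinite (cluster K z) \<and> R (K, z)) \<in> sets \<mu>"
    unfolding eq using meas by (intro sets.countable_INT) auto
  show "measure \<mu> (event (\<lambda>(K, z). infinite (cluster K z) \<and> R (K, z)))
      \<le> measure \<mu> (event (?Q k))"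
    unfolding eq using meas by (intro limit.finite_measure_mono) auto
qed

section \<open>The local limit of the largest component\<close>

lemma giant_fraction_close:
  assumes giant: "\<And>n \<omega>. n \<ge> 1 \<Longrightarrow> \<omega> \<in> space (M n) \<Longrightarrow> largest_cluster (G n \<omega>) (Cmax n \<omega>)"
    and pairs: "(\<lambda>k. limsup (\<lambda>n. ereal (1 / (real n)\<^sup>2 *
      (\<integral>\<omega>. real (card (large_pairs k (G n \<omega>))) \<partial>M n)))) \<longlonglongrightarrow> 0"
    and survival: "measure \<mu> (event (\<lambda>(K, z). infinite (cluster K z))) > 0"
    and R: "ball_determined r R R'" and R': "ball_determined r R' R'"
    and "\<epsilon> > 0" "\<delta> > 0"
  shows "eventually_outside M \<delta> (\<lambda>n \<omega>.
    \<bar>1 / real n * (\<Sum>v\<in>Cmax n \<omega>. of_bool (R (G n \<omega>, v)))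
      - measure \<mu> (event (\<lambda>(K, z). infinite (cluster K z) \<and> R' (K, z)))\<bar> \<le> \<epsilon>)"
proof -
  define a where "a = measure \<mu> (event (\<lambda>(K, z). infinite (cluster K z) \<and> R' (K, z)))"
  define \<zeta> where "\<zeta> = measure \<mu> (event (\<lambda>(K, z). infinite (cluster K z)))"
  define a_at where "a_at k = measure \<mu> (event (\<lambda>X. cluster_at_least k X \<and> R' X))" for k
  \<comment> \<open>A density of pairs up to \<open>c\<close> costs an error of \<open>c / (\<zeta> / 2) = \<epsilon> / 3\<close> when the largest
    component replaces the union of the large ones.\<close>
  define c where "c = \<epsilon> / 3 * (\<zeta> / 2)"
  have "\<zeta> > 0" using survival by (simp add: \<zeta>_def)
  then have "c > 0" using \<open>\<epsilon> > 0\<close> by (simp add: c_def)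
  have "a_at \<longlonglongrightarrow> a"
    using measure_large_cluster_tendsto(1)[OF R'] unfolding a_at_def a_def .
  then have "\<forall>\<^sub>F k in sequentially. dist (a_at k) a < \<epsilon> / 3"
    using \<open>\<epsilon> > 0\<close> by (intro tendstoD) auto
  moreover have "\<forall>\<^sub>F k in sequentially. limsup (\<lambda>n. ereal (1 / (real n)\<^sup>2 *
      (\<integral>\<omega>. real (card (large_pairs k (G n \<omega>))) \<partial>M n))) < ereal (c * (\<delta> / 3))"
    using \<open>c > 0\<close> \<open>\<delta> > 0\<close> by (intro order_tendstoD(2)[OF pairs]) simp
  \<comment> \<open>From here on \<open>k\<close> is fixed and only \<open>n\<close> tends to infinity.\<close>
  ultimately obtain k where k: "dist (a_at k) a < \<epsilon> / 3"
    and lim: "limsup (\<lambda>n. ereal (1 / (real n)\<^sup>2 *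
      (\<integral>\<omega>. real (card (large_pairs k (G n \<omega>))) \<partial>M n))) < ereal (c * (\<delta> / 3))"
    using eventually_happens'[OF sequentially_bot eventually_conj] by blast
  have "eventually_outside M (\<delta> / 3) (\<lambda>n \<omega>.
      \<bar>vertex_fraction (\<lambda>X. cluster_at_least k X \<and> R X) (G n \<omega>) - a_at k\<bar> \<le> \<epsilon> / 3)"
    unfolding a_at_def using \<open>\<epsilon> > 0\<close> \<open>\<delta> > 0\<close>
    by (intro vertex_fraction_close[of "max r k"] ball_determined_conj ball_determined_mono[OF R]
        ball_determined_mono[OF R'] ball_determined_mono[OF ball_determined_cluster_at_least]) auto
  moreover have "eventually_outside M (\<delta> / 3) (\<lambda>n \<omega>.
      \<zeta> / 2 \<le> vertex_fraction (cluster_at_least k) (G n \<omega>))"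
  proof -
    have "\<zeta> \<le> measure \<mu> (event (cluster_at_least k))"
      using measure_large_cluster_tendsto(3)[of 0 "\<lambda>_. True" k]
      by (simp add: \<zeta>_def ball_determined_def)
    moreover have "eventually_outside M (\<delta> / 3) (\<lambda>n \<omega>. measure \<mu> (event (cluster_at_least k)) - \<zeta> / 2
        \<le> vertex_fraction (cluster_at_least k) (G n \<omega>))"
      using \<open>\<zeta> > 0\<close> \<open>\<delta> > 0\<close>
      by (intro vertex_fraction_lower[OF ball_determined_cluster_at_least
            ball_determined_cluster_at_least]) auto
    ultimately show ?thesis by (elim eventually_outside_mono) simp
  qed
  moreover have "eventually_outside M (\<delta> / 3) (\<lambda>n \<omega>.
      1 / (real n)\<^sup>2 * real (card (large_pairs k (G n \<omega>))) \<le> c)"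
    unfolding eventually_outside_def
    using Limsup_lessD[OF lim] eventually_ge_at_top[of 1]
  proof eventually_elim
    case (elim n)
    interpret prob_space "M n" using random[of n] elim by (simp add: random_graph_def)
    let ?f = "\<lambda>\<omega>. 1 / (real n)\<^sup>2 * real (card (large_pairs k (G n \<omega>)))"
    have f_meas [measurable]: "?f \<in> borel_measurable (M n)"
      by (rule measurable_functional[OF elim(2)])
    have "AE \<omega> in M n. norm (?f \<omega>) \<le> 1"
    proof (rule AE_I2)
      fix \<omega> assume \<omega>: "\<omega> \<in> space (M n)"
      have "card (large_pairs k (G n \<omega>)) \<le> card (verts (G n \<omega>) \<times> verts (G n \<omega>))"
        using graph_props(3)[of n \<omega>] elim \<omega> by (intro card_mono) (auto simp: large_pairs_def)
      then have "card (large_pairs k (G n \<omega>)) \<le> n ^ 2"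
        using card_verts[of n \<omega>] elim \<omega> by (simp add: card_cartesian_product power2_eq_square)
      then have "real (card (large_pairs k (G n \<omega>))) \<le> (real n)\<^sup>2"
        by (metis of_nat_le_iff of_nat_power)
      then show "norm (?f \<omega>) \<le> 1" using elim by (simp add: field_simps)
    qed
    then have int: "integrable (M n) ?f" using f_meas by (rule integrable_const_bound)
    have "measure (M n) {\<omega>\<in>space (M n). ?f \<omega> \<ge> c} \<le> (\<integral>\<omega>. ?f \<omega> \<partial>M n) / c"
      using int \<open>c > 0\<close> by (intro integral_Markov_inequality_measure[where A = "{}"]) auto
    also have "\<dots> \<le> c * (\<delta> / 3) / c"
      using elim(1) \<open>c > 0\<close> by (intro divide_right_mono) auto
    also have "\<dots> = \<delta> / 3" using \<open>c > 0\<close> by simp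
    finally have "measure (M n) {\<omega>\<in>space (M n). ?f \<omega> \<ge> c} \<le> \<delta> / 3" .
    moreover have "{\<omega>\<in>space (M n). ?f \<omega> \<ge> c} \<in> sets (M n)"
      using borel_measurable_const f_meas by (rule borel_measurable_le)
    moreover have "\<forall>\<omega>\<in>space (M n) - {\<omega>\<in>space (M n). ?f \<omega> \<ge> c}. ?f \<omega> \<le> c"
      by (intro ballI) (simp only: Diff_iff mem_Collect_eq, linarith)
    ultimately show ?case by blast
  qed
  ultimately have "eventually_outside M (\<delta> / 3 + (\<delta> / 3 + \<delta> / 3)) (\<lambda>n \<omega>.
      \<bar>vertex_fraction (\<lambda>X. cluster_at_least k X \<and> R X) (G n \<omega>) - a_at k\<bar> \<le> \<epsilon> / 3 \<and>
      \<zeta> / 2 \<le> vertex_fraction (cluster_at_least k) (G n \<omega>) \<and>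
      1 / (real n)\<^sup>2 * real (card (large_pairs k (G n \<omega>))) \<le> c)"
    by (intro eventually_outside_conj)
  then have "eventually_outside M (\<delta> / 3 + (\<delta> / 3 + \<delta> / 3)) (\<lambda>n \<omega>.
      \<bar>1 / real n * (\<Sum>v\<in>Cmax n \<omega>. of_bool (R (G n \<omega>, v))) - a\<bar> \<le> \<epsilon>)"
  proof (rule eventually_outside_mono, elim conjE)
    fix n \<omega> assume n: "n \<ge> 1" "\<omega> \<in> space (M n)"
      and 1: "\<bar>vertex_fraction (\<lambda>X. cluster_at_least k X \<and> R X) (G n \<omega>) - a_at k\<bar> \<le> \<epsilon> / 3"
      and 2: "\<zeta> / 2 \<le> vertex_fraction (cluster_at_least k) (G n \<omega>)"
      and 3: "1 / (real n)\<^sup>2 * real (card (large_pairs k (G n \<omega>))) \<le> c"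
    have "\<bar>vertex_fraction (\<lambda>X. cluster_at_least k X \<and> R X) (G n \<omega>)
        - 1 / real n * (\<Sum>v\<in>Cmax n \<omega>. of_bool (R (G n \<omega>, v)))\<bar>
        \<le> 1 / (real n)\<^sup>2 * real (card (large_pairs k (G n \<omega>))) / (\<zeta> / 2)"
      using largest_cluster_fraction_close[OF graph_props(3)[OF n] giant[OF n] _ 2, of R]
        \<open>\<zeta> > 0\<close> by (simp add: card_verts[OF n])
    also have "\<dots> \<le> c / (\<zeta> / 2)"
      using 3 \<open>\<zeta> > 0\<close> by (intro divide_right_mono) auto
    also have "\<dots> = \<epsilon> / 3" using \<open>\<zeta> > 0\<close> by (simp add: c_def)
    finally show "\<bar>1 / real n * (\<Sum>v\<in>Cmax n \<omega>. of_bool (R (G n \<omega>, v))) - a\<bar> \<le> \<epsilon>"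
      using 1 k unfolding dist_real_def by linarith
  qed
  then show ?thesis by (simp add: a_def)
qed

lemma event_finite_cluster_eq:
  assumes "ball_determined r R R"
  shows "measure \<mu> (event (\<lambda>(K, z). finite (cluster K z) \<and> R (K, z)))
    = measure \<mu> (event R) - measure \<mu> (event (\<lambda>(K, z). infinite (cluster K z) \<and> R (K, z)))"
proof -
  let ?I = "\<lambda>(K, z). infinite (cluster K z) \<and> R (K, z)"
  have inv_R: "iso_invariant R" using assms by (rule iso_invariant_if_ball_determined)
  have "iso_invariant (\<lambda>X. infinite (cluster (fst X) (snd X)))"
  proof -
    have "infinite (cluster (fst X) (snd X)) \<longleftrightarrow> (\<forall>k. cluster_at_least k X)" for X :: "nat rooted_graph"
      by (auto simp: cluster_at_least_def split_beta
          dest: spec[of _ "Suc (card (cluster (fst X) (snd X)))"])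
    then show ?thesis
      using iso_invariant_if_ball_determined[OF ball_determined_cluster_at_least]
      unfolding iso_invariant_def by metis
  qed
  with inv_R have inv: "iso_invariant ?I"
      "iso_invariant (\<lambda>(K, z). finite (cluster K z) \<and> R (K, z))"
    unfolding iso_invariant_def split_beta prod.collapse by blast+
  have "event (\<lambda>(K, z). finite (cluster K z) \<and> R (K, z)) = event R - event ?I"
  proof (rule event_eqI[OF _ inv(2)])
    fix Y assume "Y \<in> nat_rooted_graphs"
    then show "iso_class_of Y \<in> event R - event ?I \<longleftrightarrow>
        (case Y of (K, z) \<Rightarrow> finite (cluster K z) \<and> R (K, z))"
      by (cases Y) (auto simp: iso_class_of_in_event_iff[OF inv_R] iso_class_of_in_event_iff[OF inv(1)])
  qed (use event_subset_G_star in blast)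
  moreover have "event ?I \<subseteq> event R" by (auto simp: event_def)
  ultimately show ?thesis
    using event_in_sets[OF assms] measure_large_cluster_tendsto(2)[OF assms] sets_limit
    by (simp add: limit.finite_measure_Diff)
qed

lemma nongiant_fraction_close:
  assumes giant: "\<And>n \<omega>. n \<ge> 1 \<Longrightarrow> \<omega> \<in> space (M n) \<Longrightarrow> largest_cluster (G n \<omega>) (Cmax n \<omega>)"
    and R: "ball_determined r R R'" and R': "ball_determined r R' R'"
    and close: "eventually_outside M (\<delta> / 2) (\<lambda>n \<omega>.
    \<bar>1 / real n * (\<Sum>v\<in>Cmax n \<omega>. of_bool (R (G n \<omega>, v)))
      - measure \<mu> (event (\<lambda>(K, z). infinite (cluster K z) \<and> R' (K, z)))\<bar> \<le> \<epsilon> / 2)"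
    and "\<epsilon> > 0" "\<delta> > 0"
  shows "eventually_outside M \<delta> (\<lambda>n \<omega>.
    \<bar>1 / real n * (\<Sum>v\<in>verts (G n \<omega>) - Cmax n \<omega>. of_bool (R (G n \<omega>, v)))
      - measure \<mu> (event (\<lambda>(K, z). finite (cluster K z) \<and> R' (K, z)))\<bar> \<le> \<epsilon>)"
proof -
  have "eventually_outside M (\<delta> / 2 + \<delta> / 2) (\<lambda>n \<omega>.
    \<bar>1 / real n * (\<Sum>v\<in>Cmax n \<omega>. of_bool (R (G n \<omega>, v)))
      - measure \<mu> (event (\<lambda>(K, z). infinite (cluster K z) \<and> R' (K, z)))\<bar> \<le> \<epsilon> / 2 \<and>
    \<bar>vertex_fraction R (G n \<omega>) - measure \<mu> (event R')\<bar> \<le> \<epsilon> / 2)"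
    using \<open>\<epsilon> > 0\<close> \<open>\<delta> > 0\<close>
    by (intro eventually_outside_conj close vertex_fraction_close[OF R R']) auto
  then show ?thesis
    unfolding field_sum_of_halves event_finite_cluster_eq[OF R']
  proof (rule eventually_outside_mono, elim conjE)
    fix n \<omega> assume n: "n \<ge> 1" "\<omega> \<in> space (M n)"
      and 1: "\<bar>1 / real n * (\<Sum>v\<in>Cmax n \<omega>. of_bool (R (G n \<omega>, v)))
        - measure \<mu> (event (\<lambda>(K, z). infinite (cluster K z) \<and> R' (K, z)))\<bar> \<le> \<epsilon> / 2"
      and 2: "\<bar>vertex_fraction R (G n \<omega>) - measure \<mu> (event R')\<bar> \<le> \<epsilon> / 2"
    have "Cmax n \<omega> \<subseteq> verts (G n \<omega>)"
      using giant[OF n] by (auto simp: largest_cluster_def cluster_def)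
    then have "1 / real n * (\<Sum>v\<in>verts (G n \<omega>) - Cmax n \<omega>. of_bool (R (G n \<omega>, v)))
        = vertex_fraction R (G n \<omega>) - 1 / real n * (\<Sum>v\<in>Cmax n \<omega>. of_bool (R (G n \<omega>, v)))"
      unfolding vertex_fraction_def card_verts[OF n] using graph_props(3)[OF n]
      by (simp only: sum_diff right_diff_distrib)
    then show "\<bar>1 / real n * (\<Sum>v\<in>verts (G n \<omega>) - Cmax n \<omega>. of_bool (R (G n \<omega>, v)))
      - (measure \<mu> (event R') - measure \<mu> (event (\<lambda>(K, z). infinite (cluster K z) \<and> R' (K, z))))\<bar> \<le> \<epsilon>"
      using 1 2 unfolding abs_le_iff by linarith
  qed
qed

end

theorem theorem2p5:
  fixes M :: "nat \<Rightarrow> 'a measure"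
    and G :: "nat \<Rightarrow> 'a \<Rightarrow> 'v graph"
    and Cmax :: "nat \<Rightarrow> 'a \<Rightarrow> 'v set"
    and \<mu> :: "nat rooted_graph set measure"
  assumes "\<And>n. n \<ge> 1 \<Longrightarrow> random_graph (M n) (G n)"
    and "\<And>n \<omega>. n \<ge> 1 \<Longrightarrow> \<omega> \<in> space (M n) \<Longrightarrow> card (verts (G n \<omega>)) = n"
    and "\<And>n. n \<ge> 1 \<Longrightarrow> Cmax n \<in> measurable (M n) (count_space UNIV)"
    and "\<And>n \<omega>. n \<ge> 1 \<Longrightarrow> \<omega> \<in> space (M n) \<Longrightarrow> largest_cluster (G n \<omega>) (Cmax n \<omega>)"
    and "prob_space \<mu>" and "sets \<mu> = sets local_borel"
    and "tendsto_locally_in_prob M G \<mu>"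
    and "(\<lambda>k::nat. limsup (\<lambda>n. ereal (1 / (real n)\<^sup>2 *
            (\<integral>\<omega>. real (card {(x, y). x \<in> verts (G n \<omega>) \<and> y \<in> verts (G n \<omega>) \<and>
                 card (cluster (G n \<omega>) x) \<ge> k \<and> card (cluster (G n \<omega>) y) \<ge> k \<and>
                 x \<notin> cluster (G n \<omega>) y}) \<partial>M n)))) \<longlonglongrightarrow> 0"
    and "measure \<mu> (event (\<lambda>(K, z). infinite (cluster K z))) > 0"
  shows "\<forall>r. \<forall>H\<in>G_star.
      tendsto_in_prob M
        (\<lambda>n \<omega>. 1 / real n *
           (\<Sum>v\<in>Cmax n \<omega>. of_bool (graph_ball r (G n \<omega>, v) \<simeq>\<^sub>\<star> H)))
        (measure \<mu> (event (\<lambda>(K, z). infinite (cluster K z) \<and> graph_ball r (K, z) \<simeq>\<^sub>\<star> H))) \<and>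
      tendsto_in_prob M
        (\<lambda>n \<omega>. 1 / real n *
           (\<Sum>v\<in>verts (G n \<omega>) - Cmax n \<omega>. of_bool (graph_ball r (G n \<omega>, v) \<simeq>\<^sub>\<star> H)))
        (measure \<mu> (event (\<lambda>(K, z). finite (cluster K z) \<and> graph_ball r (K, z) \<simeq>\<^sub>\<star> H)))"
proof (intro allI ballI)
  fix r and H :: "nat rooted_graph set"
  interpret local_limit M G \<mu> using assms(1,2,5-7) by (rule local_limit.intro)
  let ?R = "\<lambda>X. graph_ball r X \<simeq>\<^sub>\<star> H"
  have prob: "prob_space (M n)" if "n \<ge> 1" for n
    using assms(1)[OF that] by (simp add: random_graph_def)
  have giant: "eventually_outside M \<delta> (\<lambda>n \<omega>.
      \<bar>1 / real n * (\<Sum>v\<in>Cmax n \<omega>. of_bool (graph_ball r (G n \<omega>, v) \<simeq>\<^sub>\<star> H))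
        - measure \<mu> (event (\<lambda>(K, z). infinite (cluster K z) \<and> graph_ball r (K, z) \<simeq>\<^sub>\<star> H))\<bar> \<le> \<epsilon>)"
    if "\<epsilon> > 0" "\<delta> > 0" for \<epsilon> \<delta>
    using giant_fraction_close[OF assms(4) _ assms(9) ball_determined_graph_ball[of r H]
        ball_determined_graph_ball[of r H] that] assms(8)
    unfolding large_pairs_def by blast
  have rest: "eventually_outside M \<delta> (\<lambda>n \<omega>.
      \<bar>1 / real n * (\<Sum>v\<in>verts (G n \<omega>) - Cmax n \<omega>. of_bool (graph_ball r (G n \<omega>, v) \<simeq>\<^sub>\<star> H))
        - measure \<mu> (event (\<lambda>(K, z). finite (cluster K z) \<and> graph_ball r (K, z) \<simeq>\<^sub>\<star> H))\<bar> \<le> \<epsilon>)"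
    if "\<epsilon> > 0" "\<delta> > 0" for \<epsilon> \<delta>
  proof (rule nongiant_fraction_close[OF assms(4) ball_determined_graph_ball[of r H]
        ball_determined_graph_ball[of r H] giant that])
    show "\<epsilon> / 2 > 0" "\<delta> / 2 > 0" using that by auto
  qed
  show "tendsto_in_prob M
        (\<lambda>n \<omega>. 1 / real n *
           (\<Sum>v\<in>Cmax n \<omega>. of_bool (graph_ball r (G n \<omega>, v) \<simeq>\<^sub>\<star> H)))
        (measure \<mu> (event (\<lambda>(K, z). infinite (cluster K z) \<and> graph_ball r (K, z) \<simeq>\<^sub>\<star> H))) \<and>
      tendsto_in_prob M
        (\<lambda>n \<omega>. 1 / real n *
           (\<Sum>v\<in>verts (G n \<omega>) - Cmax n \<omega>. of_bool (graph_ball r (G n \<omega>, v) \<simeq>\<^sub>\<star> H)))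
        (measure \<mu> (event (\<lambda>(K, z). finite (cluster K z) \<and> graph_ball r (K, z) \<simeq>\<^sub>\<star> H)))"
    using giant rest by (intro conjI tendsto_in_probI[OF prob])
qed

end
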